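(* For every fixed integer $n \geq 1$ and every real $\epsilon > 0$, there is $h_0(n,\epsilon)$ such that \[ \frac{1}{n!\,\delta_L(\triangle^n)}\, h^n \;\leq\; \phi(h,n) \;<\; \frac{1+\epsilon}{n!\,\delta_L(\triangle^n)}\, h^n , \] where the lower bound is valid for every integer $h \geq 1$ and the upper bound for every integer $h \geq h_0(n,\epsilon)$. Consequently, for every $n \geq 1$, the limit below exists and \[ \lim_{h\to\infty} \frac{\phi(h,n)}{h^n} = \frac{1}{n!\,\delta_L(\triangle^n)} . \]
   Context: Let $h,n$ be positive integers. A subset $B=\{b_0,b_1,\ldots,b_n\}$ (of cardinality $n+1$) of a finite additive Abelian group $G$ is a $B_h$ set (Sidon set of order $h$) if all the sums $b_{i_1}+\cdots+b_{i_h}$ with $0\leq i_1\leq\cdots\leq i_h\leq n$ are different. $\phi(h,n)$ denotes the order (cardinality) of the smallest finite Abelian group (not necessarily cyclic) containing a $B_h$ set of cardinality $n+1$. The simplex: $\triangle^n = \{\mathbf{x}\in\mathbb{R}^n : x_i\geq 0 \text{ for all } i,\ \sum_{i=1}^n x_i\leq 1\}$, of volume $1/n!$. A (full-rank) lattice in $\mathbb{R}^n$ is a set $\mathcal{L}=\{\alpha_1\mathbf{v}_1+\cdots+\alpha_n\mathbf{v}_n:\alpha_i\in\mathbb{Z}\}$ with $\mathbf{v}_1,\ldots,\mathbf{v}_n\in\mathbb{R}^n$ linearly independent; $\det(\mathcal{L})=|\det(\mathbf{v}_1,\ldots,\mathbf{v}_n)|$. For a compact convex set $K\subset\mathbb{R}^n$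 with non-empty interior, $(K,\mathcal{L})$ is a lattice packing if for all distinct $\mathbf{x},\mathbf{y}\in\mathcal{L}$ the translates $K+\mathbf{x}$ and $K+\mathbf{y}$ have no interior points in common. Its density is $\delta(K,\mathcal{L})=\operatorname{vol}(K)/\det(\mathcal{L})$, and the lattice packing density of $K$ is $\delta_L(K)=\sup_{\mathcal{L}}\delta(K,\mathcal{L})$, the supremum being over all lattices $\mathcal{L}$ in $\mathbb{R}^n$ such that $(K,\mathcal{L})$ is a lattice packing. *)

theory Defs
  imports "HOL-Analysis.Analysis" "HOL-Algebra.Weak_Morphisms"
begin

section \<open>Sidon sets of order h in finite Abelian groups\<close>

text \<open>The index tuples \<open>0 \<le> i\<^sub>1 \<le> \<dots> \<le> i\<^sub>h \<le> n\<close>.\<close>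

definition index_tuples :: "nat \<Rightarrow> nat \<Rightarrow> (nat \<Rightarrow> nat) set" where
  "index_tuples h n = {i \<in> {1..h} \<rightarrow>\<^sub>E {0..n}. mono_on {1..h} i}"

text \<open>Abelian groups are written multiplicatively in HOL-Algebra, so the sum
  \<open>b\<^bsub>i\<^sub>1\<^esub> + \<dots> + b\<^bsub>i\<^sub>h\<^esub>\<close> is a \<^const>\<open>finprod\<close>. The predicate includes
  that \<open>B\<close> has exactly \<open>n + 1\<close> elements.\<close>

definition Bh_set :: "('a, 'c) monoid_scheme \<Rightarrow> nat \<Rightarrow> nat \<Rightarrow> 'a set \<Rightarrow> bool" where
  "Bh_set G h n B \<longleftrightarrow> B \<subseteq> carrier G \<and>
     (\<exists>b. bij_betw b {0..n} B \<and>
          inj_on (\<lambda>i. \<Otimes>\<^bsub>G\<^esub>j\<in>{1..h}. b (i j)) (index_tuples h n))"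

text \<open>Every finite group has an isomorphic copy whose carrier is a set of natural numbers, so
  it suffices to let \<open>G\<close> range over such groups; see \<open>Bh_order_le\<close> below.\<close>

definition Bh_order :: "nat \<Rightarrow> nat \<Rightarrow> nat" ("\<phi>") where
  "\<phi> h n = (LEAST m. \<exists>G :: nat monoid. comm_group G \<and> finite (carrier G) \<and> order G = m \<and>
                        (\<exists>B. Bh_set G h n B))"

lemma Bh_set_iso:
  assumes "comm_group G" "comm_group H" "f \<in> iso G H" "Bh_set G h n B"
  shows "Bh_set H h n (f ` B)"
proof -
  interpret G: comm_group G by fact
  interpret H: comm_group H by fact
  from assms(3) have hom: "f \<in> hom G H" and inj: "inj_on f (carrier G)"
    and img: "f ` carrier G = carrier H"
    by (auto simp: iso_def bij_betw_def)
  from assms(4) obtain b where B: "B \<subseteq> carrier G" and b: "bij_betw b {0..n} B"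
    and inj_b: "inj_on (\<lambda>i. \<Otimes>\<^bsub>G\<^esub>j\<in>{1..h}. b (i j)) (index_tuples h n)"
    unfolding Bh_set_def by auto
  have bG: "b k \<in> carrier G" if "k \<le> n" for k
    using that b B by (auto simp: bij_betw_def)
  have ile: "i j \<le> n" if "i \<in> index_tuples h n" "j \<in> {1..h}" for i j
    using that by (auto simp: index_tuples_def PiE_def Pi_def)
  have prod_hom: "f (finprod G g A) = finprod H (\<lambda>a. f (g a)) A" if "finite A" "g \<in> A \<rightarrow> carrier G"
    for g and A :: "nat set"
    using that
  proof (induction A rule: finite_induct)
    case empty
    show ?case using hom_one[OF hom] G.is_group H.is_group by simp
  next
    case (insert x A)
    have "f y \<in> carrier H" if "y \<in> carrier G" for y using hom that by (auto simp: hom_def)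
    then have 1: "(\<lambda>a. f (g a)) \<in> A \<rightarrow> carrier H" "f (g x) \<in> carrier H" using insert.prems by (auto simp: Pi_iff)
    have 2: "g \<in> A \<rightarrow> carrier G" "g x \<in> carrier G" using insert.prems by auto
    show ?case
      using insert.hyps insert.IH[OF 2(1)] 1 2 hom_mult[OF hom 2(2) G.finprod_closed[OF 2(1)]]
      by (simp add: G.finprod_insert H.finprod_insert)
  qed
  have "inj_on (\<lambda>i. \<Otimes>\<^bsub>H\<^esub>j\<in>{1..h}. (f \<circ> b) (i j)) (index_tuples h n)"
  proof (rule inj_onI)
    fix i i' assume i: "i \<in> index_tuples h n" "i' \<in> index_tuples h n"
      and eq: "(\<Otimes>\<^bsub>H\<^esub>j\<in>{1..h}. (f \<circ> b) (i j)) = (\<Otimes>\<^bsub>H\<^esub>j\<in>{1..h}. (f \<circ> b) (i' j))"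
    have car: "(\<lambda>j. b (i j)) \<in> {1..h} \<rightarrow> carrier G" "(\<lambda>j. b (i' j)) \<in> {1..h} \<rightarrow> carrier G"
      using bG ile i by auto
    have "f (\<Otimes>\<^bsub>G\<^esub>j\<in>{1..h}. b (i j)) = f (\<Otimes>\<^bsub>G\<^esub>j\<in>{1..h}. b (i' j))"
      using eq prod_hom[OF _ car(1)] prod_hom[OF _ car(2)] by (simp add: o_def)
    then have "(\<Otimes>\<^bsub>G\<^esub>j\<in>{1..h}. b (i j)) = (\<Otimes>\<^bsub>G\<^esub>j\<in>{1..h}. b (i' j))"
      using inj car by (auto dest!: inj_onD intro: G.finprod_closed)
    then show "i = i'" using inj_b i by (auto dest: inj_onD)
  qed
  moreover have "bij_betw (f \<circ> b) {0..n} (f ` B)"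
    using b inj B by (meson bij_betw_trans inj_on_imp_bij_betw inj_on_subset)
  moreover have "f ` B \<subseteq> carrier H" using B img by blast
  ultimately show ?thesis unfolding Bh_set_def by blast
qed

lemma Bh_order_le:
  fixes G :: "('a, 'c) monoid_scheme"
  assumes "comm_group G" "finite (carrier G)" "Bh_set G h n B"
  shows "\<phi> h n \<le> order G"
proof -
  interpret G: comm_group G by fact
  obtain f :: "'a \<Rightarrow> nat" where f: "inj_on f (carrier G)"
    using finite_imp_inj_to_nat_seg[OF assms(2)] by blast
  define H where "H = image_group f G"
  have iso: "f \<in> iso G H" unfolding H_def by (rule inj_imp_image_group_iso[OF f])
  have "group H" unfolding H_def by (rule G.inj_imp_image_group_is_group[OF f])
  then have H: "comm_group H"
    using G.iso_imp_comm_group[of H] iso by (auto simp: is_iso_def group.is_monoid)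
  have car: "carrier H = f ` carrier G" by (simp add: H_def image_group_carrier)
  have "finite (carrier H)" "order H = order G"
    using assms(2) f by (auto simp: car order_def card_image)
  moreover have "Bh_set H h n (f ` B)" by (rule Bh_set_iso[OF assms(1) H iso assms(3)])
  ultimately show ?thesis unfolding Bh_order_def
    by (intro Least_le) (use H in blast)
qed

section \<open>Lattices and lattice packings\<close>

text \<open>A tuple of \<open>n\<close> vectors of \<open>\<real>\<^sup>n\<close> is encoded as the matrix with these rows. Linear
  independence of the tuple means that its entries are distinct and form an independent set.\<close>

definition lin_indep_rows :: "real^'n^'n \<Rightarrow> bool" where
  "lin_indep_rows v \<longleftrightarrow> inj (\<lambda>i. v $ i) \<and> independent (range (\<lambda>i. v $ i))"

definition int_span :: "real^'n^'n \<Rightarrow> (real^'n) set" where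
  "int_span v = {\<Sum>i\<in>UNIV. of_int (\<alpha> i) *\<^sub>R (v $ i) | \<alpha> :: 'n \<Rightarrow> int. True}"

definition lattice_basis :: "real^'n^'n \<Rightarrow> (real^'n) set \<Rightarrow> bool" where
  "lattice_basis v L \<longleftrightarrow> lin_indep_rows v \<and> L = int_span v"

definition is_lattice :: "(real^'n) set \<Rightarrow> bool" where
  "is_lattice L \<longleftrightarrow> (\<exists>v. lattice_basis v L)"

text \<open>The choice of the basis is irrelevant, see \<open>lattice_det_eq\<close> below.\<close>

definition lattice_det :: "(real^'n) set \<Rightarrow> real" where
  "lattice_det L = \<bar>det (SOME v. lattice_basis v L)\<bar>"

lemma lin_indep_rows_det: "lin_indep_rows v \<Longrightarrow> det v \<noteq> 0"
proof -
  assume v: "lin_indep_rows v"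
  have "rows v = range (\<lambda>i. v $ i)" by (auto simp: rows_def row_def)
  moreover have "row i v = v $ i" for i by (simp add: row_def)
  moreover have "card (range (\<lambda>i. v $ i)) = CARD('a)"
    using v by (simp add: lin_indep_rows_def card_image)
  ultimately have "rank v = CARD('a)"
    using v by (simp add: lin_indep_rows_def row_rank_def dim_eq_card_independent)
  then show ?thesis by (simp add: det_eq_0_rank)
qed

lemma int_span_subset_imp_int_matrix:
  fixes v w :: "real^'n^'n"
  assumes "int_span w \<subseteq> int_span v"
  shows "\<exists>A :: real^'n^'n. (\<forall>i j. A $ i $ j \<in> \<int>) \<and> w = A ** v"
proof -
  have "w $ i \<in> int_span w" for i
  proof -
    have "w $ i = (\<Sum>j\<in>UNIV. of_int (if j = i then 1 else 0) *\<^sub>R (w $ j))"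
      by (simp add: if_distrib[of "\<lambda>x. x *\<^sub>R _"] if_distrib[of real_of_int] cong: if_cong)
    then show ?thesis unfolding int_span_def mem_Collect_eq
      by (intro exI[of _ "\<lambda>j. if j = i then 1 else 0"]) simp
  qed
  then have "\<forall>i. \<exists>\<alpha> :: 'n \<Rightarrow> int. w $ i = (\<Sum>j\<in>UNIV. of_int (\<alpha> j) *\<^sub>R (v $ j))"
    using assms unfolding int_span_def by blast
  then obtain \<alpha> :: "'n \<Rightarrow> 'n \<Rightarrow> int"
    where \<alpha>: "w $ i = (\<Sum>j\<in>UNIV. of_int (\<alpha> i j) *\<^sub>R (v $ j))" for i
    by metis
  have "w = (\<chi> i j. of_int (\<alpha> i j)) ** v"
    by (simp add: vec_eq_iff matrix_matrix_mult_def \<alpha>)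
  then show ?thesis by (intro exI[of _ "\<chi> i j. of_int (\<alpha> i j)"]) auto
qed

lemma lattice_det_eq:
  fixes v :: "real^'n^'n"
  assumes "lattice_basis v L"
  shows "lattice_det L = \<bar>det v\<bar>"
proof -
  define w where "w = (SOME v. lattice_basis v L)"
  have w: "lattice_basis w L" unfolding w_def using assms by (rule someI)
  have eq: "int_span v = int_span w" using assms w by (simp add: lattice_basis_def)
  have le: "\<bar>det y\<bar> \<le> \<bar>det x\<bar>"
    if "int_span x \<subseteq> int_span y" "lattice_basis x L" for x y :: "real^'n^'n"
  proof -
    from int_span_subset_imp_int_matrix[OF that(1)] obtain A :: "real^'n^'n"
      where A: "\<forall>i j. A $ i $ j \<in> \<int>" "x = A ** y" by blast
    have "det x \<noteq> 0" using that(2) by (simp add: lattice_basis_def lin_indep_rows_det)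
    then have nz: "det A \<noteq> 0" using A by (auto simp: det_mul)
    have "det A \<in> \<int>" unfolding det_def using A(1) by (intro Ints_sum Ints_mult Ints_prod) auto
    then have "\<bar>det A\<bar> \<ge> 1" using nz by (metis Ints_nonzero_abs_ge1)
    then have "1 * \<bar>det y\<bar> \<le> \<bar>det A\<bar> * \<bar>det y\<bar>" by (intro mult_right_mono) auto
    then show ?thesis using A(2) by (simp add: det_mul abs_mult)
  qed
  have "\<bar>det w\<bar> = \<bar>det v\<bar>" using le[of w v] le[of v w] eq w assms by auto
  then show ?thesis by (simp add: lattice_det_def w_def)
qed

definition lattice_packing :: "(real^'n) set \<Rightarrow> (real^'n) set \<Rightarrow> bool" where
  "lattice_packing K L \<longleftrightarrow> is_lattice L \<and>
     (\<forall>x\<in>L. \<forall>y\<in>L. x \<noteq> y \<longrightarrow> interior ((+) x ` K) \<inter> interior ((+) y ` K) = {})"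

definition packing_density :: "(real^'n) set \<Rightarrow> (real^'n) set \<Rightarrow> real" where
  "packing_density K L = measure lebesgue K / lattice_det L"

definition lattice_packing_density :: "(real^'n) set \<Rightarrow> real" ("\<delta>\<^sub>L") where
  "\<delta>\<^sub>L K = (SUP L\<in>{L. lattice_packing K L}. packing_density K L)"

definition simplex_body :: "(real^'n) set" ("\<triangle>") where
  "\<triangle> = {x. (\<forall>i. 0 \<le> x $ i) \<and> (\<Sum>i\<in>UNIV. x $ i) \<le> 1}"

end

theory Submission
  imports Defs
begin

text \<open>
  Write \<open>N\<close> for the gauge of the difference body of the simplex (\<open>diff_norm\<close> below): \<open>N x\<close> is
  the larger of the sum of the positive parts and the sum of the negative parts of \<open>x\<close>. Two
  translates of the simplex by \<open>x\<close> and \<open>y\<close> have disjoint interiors iff \<open>N (x - y) \<ge> 1\<close>, so a lattice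
  packs the simplex iff its nonzero vectors satisfy \<open>N x \<ge> 1\<close> (\<open>lattice_packing_simplex_iff\<close>).

  Subtract \<open>b\<^sub>0\<close> from all elements of a \<open>B\<^sub>h\<close> set. The \<open>h\<close>-fold sums then become the values, at the
  integer points of \<open>h\<close> times the simplex, of the homomorphism \<open>\<psi>\<close> from the integer vectors to \<open>G\<close>
  sending the unit vectors to the \<open>b\<^sub>i - b\<^sub>0\<close>. The differences of those points are the integer vectors
  with \<open>N x \<le> h\<close>, so the \<open>B\<^sub>h\<close> property says that every nonzero kernel vector satisfies \<open>N x > h\<close>
  (\<open>inj_on_int_simplex_iff\<close>). Hence \<open>B\<^sub>h\<close> sets correspond to integral lattices with \<open>N > h\<close> off the
  origin. The group order is at least the determinant of the lattice, and equal to it when \<open>G\<close> is the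
  quotient of the integer vectors by the lattice.

  Lower bound (\<open>Bh_order_lower_bound\<close>): the kernel, shrunk by the factor \<open>h\<close>, packs the simplex, and
  its determinant is at most \<open>order G / h ^ n\<close>; comparing its density with the supremum gives the claim.

  Upper bound (\<open>Bh_order_upper_bound\<close>): take a basis \<open>v\<close> of a lattice packing of nearly optimal
  density and round \<open>(h + 1 + C) v\<close> down to an integral matrix. Rounding changes \<open>N\<close> of a lattice
  vector by at most \<open>C\<close> times its unscaled value, so after rounding all nonzero vectors satisfy
  \<open>N \<ge> h + 1\<close>, and the quotient of the integer vectors by this lattice contains a \<open>B\<^sub>h\<close> set. Its order
  is the determinant of the rounded matrix, which is asymptotic to \<open>h ^ n * \<bar>det v\<bar>\<close>.

  Index and determinant are compared through volumes. If the translates of \<open>P\<close> by a lattice are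
  disjoint and those of \<open>S\<close> cover the space, then \<open>P\<close> has at most the volume of \<open>S\<close>
  (\<open>packing_measure_le_covering_measure\<close>); one of the two sets is a half-open fundamental cell, the
  other a union of unit cubes, one for each coset.
\<close>

section \<open>Integer vectors and integral spans\<close>

definition int_vecs :: "(real^'n) set" where
  "int_vecs = {x. \<forall>i. x $ i \<in> \<int>}"

lemma int_vecs_0 [simp]: "0 \<in> int_vecs"
  and int_vecs_add: "x \<in> int_vecs \<Longrightarrow> y \<in> int_vecs \<Longrightarrow> x + y \<in> int_vecs"
  and int_vecs_diff: "x \<in> int_vecs \<Longrightarrow> y \<in> int_vecs \<Longrightarrow> x - y \<in> int_vecs"
  and int_vecs_minus: "x \<in> int_vecs \<Longrightarrow> - x \<in> int_vecs"
  by (auto simp: int_vecs_def)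

lemma int_vecs_floor: "(\<chi> i. real_of_int \<lfloor>x $ i\<rfloor>) \<in> int_vecs"
  by (simp add: int_vecs_def)

lemma countable_int_vecs: "countable (int_vecs :: (real^'n) set)"
proof -
  have "int_vecs = range (\<lambda>a :: 'n \<Rightarrow> int. (\<chi> i. real_of_int (a i)) :: real^'n)"
  proof (intro subset_antisym subsetI)
    fix x :: "real^'n" assume "x \<in> int_vecs"
    then have "x = (\<chi> i. real_of_int \<lfloor>x $ i\<rfloor>)" by (auto simp: int_vecs_def vec_eq_iff)
    then show "x \<in> range (\<lambda>a. (\<chi> i. real_of_int (a i)) :: real^'n)"
      by (rule image_eqI[of _ _ "\<lambda>i. \<lfloor>x $ i\<rfloor>"]) simp
  qed (auto simp: int_vecs_def)
  then show ?thesis by (metis countable_image countableI_type)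
qed

lemma int_span_eq_image: "int_span v = (\<lambda>c. c v* v) ` int_vecs"
proof (intro subset_antisym subsetI)
  fix x assume "x \<in> int_span v"
  then obtain a :: "'a \<Rightarrow> int" where "x = (\<Sum>i\<in>UNIV. of_int (a i) *\<^sub>R (v $ i))"
    unfolding int_span_def by blast
  then have "x = (\<chi> i. real_of_int (a i)) v* v"
    by (simp add: vec_eq_iff vector_matrix_mult_def)
  then show "x \<in> (\<lambda>c. c v* v) ` int_vecs" by (auto simp: int_vecs_def)
next
  fix x assume "x \<in> (\<lambda>c. c v* v) ` int_vecs"
  then obtain c where c: "c \<in> int_vecs" "x = c v* v" by blast
  have "x = (\<Sum>i\<in>UNIV. of_int \<lfloor>c $ i\<rfloor> *\<^sub>R (v $ i))"
    using c by (auto simp: vec_eq_iff vector_matrix_mult_def int_vecs_def intro!: sum.cong)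
  then show "x \<in> int_span v"
    unfolding int_span_def mem_Collect_eq by (intro exI[of _ "\<lambda>i. \<lfloor>c $ i\<rfloor>"]) simp
qed

lemma int_span_diff: "x \<in> int_span v \<Longrightarrow> y \<in> int_span v \<Longrightarrow> x - y \<in> int_span v"
  unfolding int_span_eq_image by (auto simp: int_vecs_diff simp flip: vector_matrix_mult_diff_distrib)

lemma int_span_0: "0 \<in> int_span v"
  unfolding int_span_eq_image by (auto intro!: image_eqI[of _ _ 0])

lemma int_span_minus: "x \<in> int_span v \<Longrightarrow> - x \<in> int_span v"
  using int_span_diff[OF int_span_0, of x v] by simp

lemma countable_int_span: "countable (int_span v)"
  by (simp add: int_span_eq_image countable_int_vecs)

lemma vector_matrix_mult_eq_0:
  fixes v :: "real^'n^'n"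
  assumes "det v \<noteq> 0" "c v* v = 0"
  shows "c = 0"
proof -
  obtain u where u: "v ** u = mat 1"
    using assms(1) invertible_det_nz[of v] by (auto simp: invertible_def)
  have "c = (c v* v) v* u" by (simp add: vector_matrix_mul_assoc u)
  then show ?thesis using assms(2) by simp
qed

text \<open>The converse direction of \<open>lin_indep_rows_det\<close> turns a nonzero determinant into a lattice basis.\<close>

lemma lin_indep_rows_iff_det: "lin_indep_rows v \<longleftrightarrow> det v \<noteq> 0"
proof
  assume d: "det v \<noteq> 0"
  have rows: "rows v = range (\<lambda>i. v $ i)" by (auto simp: rows_def row_def)
  have "inj (\<lambda>i. v $ i)"
  proof (rule injI, rule ccontr)
    fix i j assume "v $ i = v $ j" "i \<noteq> j"
    then show False using d det_identical_rows[of i j v] by (simp add: row_def)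
  qed
  moreover have "independent (rows v)"
    using d det_dependent_rows[of v] unfolding dependent_vec_eq by blast
  ultimately show "lin_indep_rows v" by (simp add: lin_indep_rows_def rows)
qed (rule lin_indep_rows_det)

lemma lattice_basis_int_span: "det v \<noteq> 0 \<Longrightarrow> lattice_basis v (int_span v)"
  by (simp add: lattice_basis_def lin_indep_rows_iff_det)

section \<open>The gauge of the difference body of the simplex\<close>

definition l1_norm :: "real^'n \<Rightarrow> real" where
  "l1_norm x = (\<Sum>i\<in>UNIV. \<bar>x $ i\<bar>)"

text \<open>The gauge of the difference body \<open>\<triangle> - \<triangle>\<close>; this form makes the triangle inequality
  evident, and \<open>diff_norm_eq_max\<close> gives the geometric one.\<close>

definition diff_norm :: "real^'n \<Rightarrow> real" where
  "diff_norm x = (l1_norm x + \<bar>\<Sum>i\<in>UNIV. x $ i\<bar>) / 2"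

lemma diff_norm_eq_max:
  "diff_norm x = max (\<Sum>i\<in>UNIV. max (x $ i) 0) (\<Sum>i\<in>UNIV. max (- x $ i) 0)"
proof -
  have "(\<Sum>i\<in>UNIV. max (x $ i) 0) + (\<Sum>i\<in>UNIV. max (- x $ i) 0) = l1_norm x"
    unfolding l1_norm_def sum.distrib[symmetric] by (intro sum.cong) (auto simp: max_def)
  moreover have "(\<Sum>i\<in>UNIV. max (x $ i) 0) - (\<Sum>i\<in>UNIV. max (- x $ i) 0) = (\<Sum>i\<in>UNIV. x $ i)"
    unfolding sum_subtractf[symmetric] by (intro sum.cong) (auto simp: max_def)
  moreover have "(a + b + \<bar>a - b\<bar>) / 2 = max a b" for a b :: real by auto
  ultimately show ?thesis unfolding diff_norm_def by metis
qed

lemma l1_norm_triangle: "l1_norm (x + y) \<le> l1_norm x + l1_norm y"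
  unfolding l1_norm_def sum.distrib[symmetric] by (intro sum_mono) simp

lemma diff_norm_triangle: "diff_norm (x + y) \<le> diff_norm x + diff_norm y"
  using l1_norm_triangle[of x y] abs_triangle_ineq[of "\<Sum>i\<in>UNIV. x $ i" "\<Sum>i\<in>UNIV. y $ i"]
  unfolding diff_norm_def by (simp add: sum.distrib field_simps)

lemma diff_norm_scaleR: "diff_norm (a *\<^sub>R x) = \<bar>a\<bar> * diff_norm x"
  by (simp add: diff_norm_def l1_norm_def abs_mult distrib_left flip: sum_distrib_left)

lemma diff_norm_le_l1_norm: "diff_norm x \<le> l1_norm x"
proof -
  have "\<bar>\<Sum>i\<in>UNIV. x $ i\<bar> \<le> l1_norm x" unfolding l1_norm_def by (rule sum_abs)
  then show ?thesis by (simp add: diff_norm_def)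
qed

lemma l1_norm_le_diff_norm: "l1_norm x \<le> 2 * diff_norm x"
  by (simp add: diff_norm_def)

lemma l1_norm_nonneg: "0 \<le> l1_norm x"
  by (simp add: l1_norm_def sum_nonneg)

lemma diff_norm_pos: "x \<noteq> 0 \<Longrightarrow> 0 < diff_norm x"
proof -
  assume "x \<noteq> 0"
  then obtain i where "x $ i \<noteq> 0" by (auto simp: vec_eq_iff)
  then have "0 < l1_norm x" unfolding l1_norm_def by (intro sum_pos2[of _ i]) auto
  then show ?thesis using l1_norm_le_diff_norm[of x] by linarith
qed

lemma diff_norm_0 [simp]: "diff_norm 0 = 0"
  by (simp add: diff_norm_def l1_norm_def)

lemma l1_norm_vector_matrix_mult:
  fixes A :: "real^'n^'n"
  shows "l1_norm (c v* A) \<le> (\<Sum>i\<in>UNIV. l1_norm (A $ i)) * l1_norm c"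
proof -
  have "l1_norm (c v* A) \<le> (\<Sum>j\<in>UNIV. \<Sum>i\<in>UNIV. \<bar>c $ i\<bar> * \<bar>A $ i $ j\<bar>)"
    unfolding l1_norm_def vector_matrix_mult_def
    by (intro sum_mono) (simp add: order_trans[OF sum_abs] flip: abs_mult)
  also have "\<dots> = (\<Sum>i\<in>UNIV. \<bar>c $ i\<bar> * l1_norm (A $ i))"
    unfolding l1_norm_def sum_distrib_left by (rule sum.swap)
  also have "\<dots> \<le> (\<Sum>i\<in>UNIV. l1_norm c * l1_norm (A $ i))"
    by (intro sum_mono mult_right_mono l1_norm_nonneg)
       (simp add: l1_norm_def member_le_sum[of _ UNIV "\<lambda>i. \<bar>c $ i\<bar>"])
  finally show ?thesis by (simp add: mult.commute flip: sum_distrib_left)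
qed

section \<open>Lattice packings of the simplex\<close>

lemma simplex_open_part_subset_interior:
  "{z. (\<forall>i. 0 < z $ i) \<and> (\<Sum>i\<in>UNIV. z $ i) < 1} \<subseteq> interior (\<triangle> :: (real^'n) set)"
proof (rule interior_maximal)
  have "open (\<Inter>i. {z :: real^'n. 0 < z $ i})"
    by (intro open_INT ballI open_Collect_less continuous_intros) auto
  moreover have "open {z :: real^'n. (\<Sum>i\<in>UNIV. z $ i) < 1}"
    by (intro open_Collect_less continuous_intros)
  ultimately have "open ((\<Inter>i. {z :: real^'n. 0 < z $ i}) \<inter> {z. (\<Sum>i\<in>UNIV. z $ i) < 1})"
    by (rule open_Int)
  moreover have "(\<Inter>i. {z :: real^'n. 0 < z $ i}) \<inter> {z. (\<Sum>i\<in>UNIV. z $ i) < 1}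
      = {z. (\<forall>i. 0 < z $ i) \<and> (\<Sum>i\<in>UNIV. z $ i) < 1}"
    by blast
  ultimately show "open {z :: real^'n. (\<forall>i. 0 < z $ i) \<and> (\<Sum>i\<in>UNIV. z $ i) < 1}"
    by metis
qed (auto simp: simplex_body_def less_imp_le)

lemma sum_less_1_interior_simplex:
  assumes "z \<in> interior (\<triangle> :: (real^'n) set)"
  shows "(\<Sum>i\<in>UNIV. z $ i) < 1"
proof -
  have "(\<triangle> :: (real^'n) set) \<subseteq> {x. 1 \<bullet> x \<le> 1}" by (auto simp: simplex_body_def inner_vec_def)
  then have "z \<in> interior {x. 1 \<bullet> x \<le> 1}" using assms interior_mono by blast
  then have "1 \<bullet> z < 1" by (simp only: interior_halfspace_le one_neq_zero mem_Collect_eq not_False_eq_True)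
  then show ?thesis by (simp add: inner_vec_def)
qed

text \<open>If \<open>N (x - y) < 1\<close>, the componentwise maximum of \<open>x\<close> and \<open>y\<close> lies in both closed translates,
  with slack in the bound on the coordinate sum, so raising all coordinates slightly gives a common
  interior point. Conversely, \<open>x + a = y + c\<close> with \<open>a\<close>, \<open>c\<close> in the interior bounds the positive part
  of \<open>x - y\<close> by \<open>c\<close> and the negative part by \<open>a\<close>.\<close>

lemma interior_translated_simplices_disjoint_iff:
  fixes x y :: "real^'n"
  shows "interior ((+) x ` \<triangle>) \<inter> interior ((+) y ` \<triangle>) = {} \<longleftrightarrow> 1 \<le> diff_norm (x - y)"
proof
  assume disj: "interior ((+) x ` \<triangle>) \<inter> interior ((+) y ` \<triangle>) = {}"
  show "1 \<le> diff_norm (x - y)"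
  proof (rule ccontr)
    assume "\<not> 1 \<le> diff_norm (x - y)"
    then have pos: "(\<Sum>i\<in>UNIV. max ((x - y) $ i) 0) < 1" and neg: "(\<Sum>i\<in>UNIV. max (- (x - y) $ i) 0) < 1"
      by (auto simp: diff_norm_eq_max)
    \<comment> \<open>Half of the smaller slack, shared equally among the coordinates.\<close>
    define \<eta> where "\<eta> = min (1 - (\<Sum>i\<in>UNIV. max ((x - y) $ i) 0)) (1 - (\<Sum>i\<in>UNIV. max (- (x - y) $ i) 0))
                          / (2 * CARD('n))"
    have \<eta>: "\<eta> > 0" using pos neg by (simp add: \<eta>_def)
    have c\<eta>: "CARD('n) * \<eta> < 1 - (\<Sum>i\<in>UNIV. max ((x - y) $ i) 0)"
             "CARD('n) * \<eta> < 1 - (\<Sum>i\<in>UNIV. max (- (x - y) $ i) 0)"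
      using pos neg by (auto simp: \<eta>_def min_def)
    define z where "z = (\<chi> i. max (x $ i) (y $ i) + \<eta>)"
    have zx: "(z - x) $ i = max (- (x - y) $ i) 0 + \<eta>" and zy: "(z - y) $ i = max ((x - y) $ i) 0 + \<eta>" for i
      by (auto simp: z_def max_def)
    have sums: "(\<Sum>i\<in>UNIV. (z - x) $ i) < 1" "(\<Sum>i\<in>UNIV. (z - y) $ i) < 1"
    proof -
      have "(\<Sum>i\<in>UNIV. (z - x) $ i) = (\<Sum>i\<in>UNIV. max (- (x - y) $ i) 0 + \<eta>)" by (rule sum.cong[OF refl zx])
      then show "(\<Sum>i\<in>UNIV. (z - x) $ i) < 1" using c\<eta> by (simp add: sum.distrib)
      have "(\<Sum>i\<in>UNIV. (z - y) $ i) = (\<Sum>i\<in>UNIV. max ((x - y) $ i) 0 + \<eta>)" by (rule sum.cong[OF refl zy])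
      then show "(\<Sum>i\<in>UNIV. (z - y) $ i) < 1" using c\<eta> by (simp add: sum.distrib)
    qed
    have "z - x \<in> interior \<triangle>"
    proof (intro subsetD[OF simplex_open_part_subset_interior] CollectI conjI allI)
      show "0 < (z - x) $ i" for i unfolding zx using \<eta> by (intro add_nonneg_pos) auto
    qed (rule sums)
    moreover have "z - y \<in> interior \<triangle>"
    proof (intro subsetD[OF simplex_open_part_subset_interior] CollectI conjI allI)
      show "0 < (z - y) $ i" for i unfolding zy using \<eta> by (intro add_nonneg_pos) auto
    qed (rule sums)
    ultimately have "z \<in> interior ((+) x ` \<triangle>) \<inter> interior ((+) y ` \<triangle>)"
      unfolding interior_translation by (auto intro: image_eqI[of _ _ "z - x"] image_eqI[of _ _ "z - y"])
    then show False using disj by blast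
  qed
next
  assume N: "1 \<le> diff_norm (x - y)"
  show "interior ((+) x ` \<triangle>) \<inter> interior ((+) y ` \<triangle>) = {}"
  proof (rule ccontr)
    assume "interior ((+) x ` \<triangle>) \<inter> interior ((+) y ` \<triangle>) \<noteq> {}"
    then obtain a c where a: "a \<in> interior \<triangle>" and c: "c \<in> interior \<triangle>" and ac: "x + a = y + c"
      unfolding interior_translation by fastforce
    have xy: "x - y = c - a" using ac by (simp add: algebra_simps)
    have nonneg: "0 \<le> a $ i" "0 \<le> c $ i" for i
      using a c interior_subset[of "\<triangle> :: (real^'n) set"] by (auto simp: simplex_body_def)
    have "(\<Sum>i\<in>UNIV. max ((x - y) $ i) 0) \<le> (\<Sum>i\<in>UNIV. c $ i)"
      unfolding xy by (intro sum_mono) (use nonneg in \<open>auto\<close>)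
    moreover have "(\<Sum>i\<in>UNIV. max (- (x - y) $ i) 0) \<le> (\<Sum>i\<in>UNIV. a $ i)"
      unfolding xy by (intro sum_mono) (use nonneg in \<open>auto\<close>)
    ultimately have "diff_norm (x - y) < 1"
      using sum_less_1_interior_simplex[OF a] sum_less_1_interior_simplex[OF c]
      by (auto simp: diff_norm_eq_max)
    then show False using N by simp
  qed
qed

lemma lattice_packing_simplex_iff:
  fixes v :: "real^'n^'n"
  assumes "det v \<noteq> 0"
  shows "lattice_packing \<triangle> (int_span v) \<longleftrightarrow> (\<forall>c\<in>int_vecs. c \<noteq> 0 \<longrightarrow> 1 \<le> diff_norm (c v* v))"
proof -
  have "is_lattice (int_span v)"
    using lattice_basis_int_span[OF assms] by (auto simp: is_lattice_def)
  then have "lattice_packing \<triangle> (int_span v) \<longleftrightarrow>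
      (\<forall>x\<in>int_span v. \<forall>y\<in>int_span v. x \<noteq> y \<longrightarrow> 1 \<le> diff_norm (x - y))"
    by (simp add: lattice_packing_def interior_translated_simplices_disjoint_iff)
  also have "\<dots> \<longleftrightarrow> (\<forall>x\<in>int_span v. x \<noteq> 0 \<longrightarrow> 1 \<le> diff_norm x)"
    using int_span_0[of v] int_span_diff[of _ v] by (metis diff_zero eq_iff_diff_eq_0)
  also have "\<dots> \<longleftrightarrow> (\<forall>c\<in>int_vecs. c \<noteq> 0 \<longrightarrow> 1 \<le> diff_norm (c v* v))"
    using vector_matrix_mult_eq_0[OF assms] by (force simp: int_span_eq_image)
  finally show ?thesis .
qed

section \<open>Comparing volumes of packing and covering sets\<close>

text \<open>Cut \<open>P\<close> into its pieces in the translates of \<open>S\<close> and move each piece back into \<open>S\<close>: the pieces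
  stay disjoint because the translates of \<open>P\<close> are.\<close>

lemma packing_measure_le_covering_measure:
  fixes P S L :: "'a::euclidean_space set"
  assumes L: "countable L" and P: "P \<in> lmeasurable" and S: "S \<in> lmeasurable"
    and cover: "P \<subseteq> (\<Union>x\<in>L. (+) x ` S)"
    and disj: "\<And>x y. \<lbrakk>x \<in> L; y \<in> L; x \<noteq> y\<rbrakk> \<Longrightarrow> (+) (- x) ` P \<inter> (+) (- y) ` P = {}"
  shows "measure lebesgue P \<le> measure lebesgue S"
proof -
  \<comment> \<open>Enumerate \<open>L\<close> by a set \<open>K\<close> of naturals, so that finite and infinite \<open>L\<close> are treated alike.\<close>
  define g where "g = from_nat_into L"
  define K where "K = to_nat_on L ` L"
  have gL: "g k \<in> L" if "k \<in> K" for k using that L by (auto simp: g_def K_def)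
  have g_inj: "k = l" if "g k = g l" "k \<in> K" "l \<in> K" for k l
    using that L by (auto simp: g_def K_def)
  have gK: "\<exists>k\<in>K. g k = x" if "x \<in> L" for x using that L by (auto simp: g_def K_def)
  define A where "A = (\<lambda>k. if k \<in> K then P \<inter> (+) (g k) ` S else {})"
  define B where "B = (\<lambda>k. if k \<in> K then (+) (- g k) ` P \<inter> S else {})"
  have trans: "(+) a ` M \<in> sets lebesgue" if "M \<in> lmeasurable" for a :: 'a and M
    using that by (intro lebesgue_sets_translation) auto
  have "A k \<in> sets lebesgue" "B k \<in> sets lebesgue" for k
    unfolding A_def B_def using trans[OF P, of "- g k"] trans[OF S, of "g k"] P S
    by (cases "k \<in> K"; simp only: if_True if_False sets.empty_sets; blast)+
  then have sets: "range A \<subseteq> sets lebesgue" "range B \<subseteq> sets lebesgue" by blast+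
  have AB: "B k = (+) (- g k) ` A k" for k
    by (force simp: A_def B_def image_iff algebra_simps)
  have eq: "emeasure lebesgue (B k) = emeasure lebesgue (A k)" for k
    using emeasure_lebesgue_affine[of 1 "- g k" "A k"] by (simp add: AB add.commute cong: image_cong_simp)
  have "P = (\<Union>k. A k)"
  proof (intro subset_antisym subsetI)
    fix p assume p: "p \<in> P"
    then obtain x where x: "x \<in> L" "p \<in> (+) x ` S" using cover by blast
    then obtain k where "k \<in> K" "g k = x" using gK by blast
    then have "p \<in> A k" using p x by (simp add: A_def)
    then show "p \<in> (\<Union>k. A k)" by blast
  qed (auto simp: A_def split: if_splits)
  then have "emeasure lebesgue P \<le> (\<Sum>k. emeasure lebesgue (A k))"
    using emeasure_subadditive_countably[of A lebesgue] sets by simp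
  also have "\<dots> = (\<Sum>k. emeasure lebesgue (B k))" by (simp add: eq)
  also have "\<dots> = emeasure lebesgue (\<Union>k. B k)"
  proof (rule suminf_emeasure[OF sets(2)])
    show "disjoint_family B"
      unfolding disjoint_family_on_def
    proof (intro ballI impI)
      fix k l :: nat assume "k \<noteq> l"
      then have "(+) (- g k) ` P \<inter> (+) (- g l) ` P = {}" if "k \<in> K" "l \<in> K"
        using that disj[OF gL gL] g_inj by metis
      then show "B k \<inter> B l = {}" by (auto simp: B_def)
    qed
  qed
  also have "\<dots> \<le> emeasure lebesgue S"
    using S by (intro emeasure_mono) (auto simp: B_def split: if_splits)
  finally show ?thesis
    using P S by (auto simp: measure_def fmeasurable_def intro!: enn2real_mono)
qed

definition half_open_cube :: "(real^'n) set" where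
  "half_open_cube = {x. \<forall>i. 0 \<le> x $ i \<and> x $ i < 1}"

lemma half_open_cube_measurable: "(half_open_cube :: (real^'n) set) \<in> lmeasurable"
  and measure_half_open_cube: "measure lebesgue (half_open_cube :: (real^'n) set) = 1"
proof -
  have eq: "half_open_cube = (\<Inter>i. {x :: real^'n. 0 \<le> x $ i} \<inter> {x. x $ i < 1})"
    by (auto simp: half_open_cube_def)
  have "half_open_cube \<in> sets (borel :: (real^'n) measure)"
    unfolding eq
    by (intro sets.finite_INT sets.Int borel_closed borel_open closed_Collect_le open_Collect_less
          continuous_intros) auto
  then have sets: "half_open_cube \<in> sets (lebesgue :: (real^'n) measure)" by simp
  have sub: "box 0 1 \<subseteq> half_open_cube" "half_open_cube \<subseteq> cbox 0 (1 :: real^'n)"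
    by (auto simp: half_open_cube_def mem_box_cart less_imp_le)
  show meas: "(half_open_cube :: (real^'n) set) \<in> lmeasurable"
    by (rule fmeasurableI2[OF lmeasurable_cbox sub(2) sets])
  have c: "measure lebesgue (cbox 0 (1 :: real^'n)) = 1"
    by (simp add: content_cbox_if_cart interval_eq_empty_cart)
  have "measure lebesgue (box 0 (1 :: real^'n)) \<le> measure lebesgue (half_open_cube :: (real^'n) set)"
    by (rule measure_mono_fmeasurable[OF sub(1) _ meas]) auto
  moreover have "measure lebesgue (half_open_cube :: (real^'n) set) \<le> measure lebesgue (cbox 0 (1 :: real^'n))"
    by (rule measure_mono_fmeasurable[OF sub(2) sets]) auto
  ultimately show "measure lebesgue (half_open_cube :: (real^'n) set) = 1"
    using c by (simp add: measure_lborel_box_eq measure_lborel_cbox_eq)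
qed

lemma half_open_cube_frac: "x - (\<chi> i. real_of_int \<lfloor>x $ i\<rfloor>) \<in> half_open_cube"
proof -
  have "x $ i < 1 + real_of_int \<lfloor>x $ i\<rfloor>" for i by linarith
  then show ?thesis by (simp add: half_open_cube_def algebra_simps)
qed

lemma half_open_cube_unique:
  assumes "x \<in> half_open_cube" "y \<in> half_open_cube" "x - y \<in> int_vecs"
  shows "x = y"
proof -
  have "x $ i = y $ i" for i
  proof -
    have "x $ i - y $ i \<in> \<int>" using assms(3) by (simp add: int_vecs_def)
    then obtain k where k: "x $ i - y $ i = real_of_int k" by (auto elim: Ints_cases)
    have "0 \<le> x $ i" "x $ i < 1" "0 \<le> y $ i" "y $ i < 1"
      using assms by (auto simp: half_open_cube_def)
    then have "\<bar>real_of_int k\<bar> < 1" unfolding k[symmetric] by linarith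
    then have "k = 0" by linarith
    then show ?thesis using k by simp
  qed
  then show ?thesis by (simp add: vec_eq_iff)
qed

text \<open>The scaling law for volumes over an index type without an order. The property is stable under composition, so it suffices to check it for
  elementary maps; for swaps and shears the absolute determinant is one, and it is enough to see
  that boxes keep their volume.\<close>

lemma measure_linear_image_cart:
  fixes f :: "real^'n \<Rightarrow> real^'n"
  assumes "linear f" "S \<in> lmeasurable"
  shows "f ` S \<in> lmeasurable \<and> measure lebesgue (f ` S) = \<bar>det (matrix f)\<bar> * measure lebesgue S"
proof -
  define scales :: "(real^'n \<Rightarrow> real^'n) \<Rightarrow> bool" where
    "scales f \<longleftrightarrow> (\<forall>S\<in>lmeasurable. f ` S \<in> lmeasurable \<and>
       measure lebesgue (f ` S) = \<bar>det (matrix f)\<bar> * measure lebesgue S)" for f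
  have boxes: "scales f"
    if "linear f" "\<bar>det (matrix f)\<bar> = 1" "\<And>a b. measure lebesgue (f ` cbox a b) = measure lebesgue (cbox a b)"
    for f
    unfolding scales_def
  proof
    fix S :: "(real^'n) set" assume "S \<in> lmeasurable"
    then show "f ` S \<in> lmeasurable \<and> measure lebesgue (f ` S) = \<bar>det (matrix f)\<bar> * measure lebesgue S"
      using measure_linear_sufficient[OF that(1), of S 1] that(2,3) by simp
  qed
  have "scales f"
  proof (rule induct_linear_elementary[OF assms(1)])
    fix f g :: "real^'n \<Rightarrow> real^'n" assume "linear f" "linear g" "scales f" "scales g"
    then show "scales (f \<circ> g)"
      unfolding scales_def image_comp[symmetric] by (simp add: matrix_compose det_mul abs_mult)
  next
    fix f :: "real^'n \<Rightarrow> real^'n" and i assume f: "linear f" "\<And>x. f x $ i = 0"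
    have "axis i 1 \<notin> range f" using f(2) by (metis axis_nth rangeE zero_neq_one)
    then have "\<not> inj f" using linear_injective_imp_surjective[OF f(1)] by auto
    then have "det (matrix f) = 0" "negligible (f ` S)" for S
      using f(1) det_nz_iff_inj negligible_linear_singular_image by blast+
    then show "scales f"
      by (simp add: scales_def negligible_iff_measure)
  next
    fix c :: "'n \<Rightarrow> real"
    have "det (matrix (\<lambda>x :: real^'n. \<chi> i. c i * x $ i)) = prod c UNIV"
      by (subst det_diagonal) (simp_all add: matrix_def axis_def)
    then show "scales (\<lambda>x. \<chi> i. c i * x $ i)"
      by (simp add: scales_def measurable_stretch measure_stretch)
  next
    fix m n :: 'n
    let ?p = "Transposition.transpose m n"
    let ?h = "\<lambda>x :: real^'n. \<chi> i. x $ ?p i"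
    have lin: "linear ?h" by (rule linearI) (simp_all add: vec_eq_iff)
    have "?h \<circ> ?h = id" by (simp add: fun_eq_iff vec_eq_iff)
    then have "det (matrix ?h) * det (matrix ?h) = 1"
      using matrix_compose[OF lin lin] by (metis det_mul matrix_id)
    then have "\<bar>det (matrix ?h)\<bar> = 1" unfolding abs_square_eq_1[symmetric] power2_eq_square .
    moreover have "measure lebesgue (?h ` cbox a b) = measure lebesgue (cbox a b)" for a b
    proof -
      have "?h ` cbox a b = cbox (?h a) (?h b)"
      proof (intro subset_antisym subsetI)
        fix y assume "y \<in> cbox (?h a) (?h b)"
        then have "?h y \<in> cbox a b" by (auto simp: mem_box_cart) (metis transpose_involutory)+
        moreover have "y = ?h (?h y)" by (simp add: vec_eq_iff)
        ultimately show "y \<in> ?h ` cbox a b" by (rule image_eqI[rotated])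
      qed (auto simp: mem_box_cart)
      moreover have "cbox (?h a) (?h b) = {} \<longleftrightarrow> cbox a b = {}"
        by (metis calculation image_is_empty)
      moreover have "(\<Prod>i\<in>UNIV. b $ ?p i - a $ ?p i) = (\<Prod>i\<in>UNIV. b $ i - a $ i)"
        by (rule prod.reindex_bij_betw[OF bij_transpose])
      ultimately show ?thesis by (simp add: content_cbox_if_cart)
    qed
    ultimately show "scales ?h" using boxes[OF lin] by blast
  next
    fix m n :: 'n assume mn: "m \<noteq> n"
    let ?h = "\<lambda>x :: real^'n. \<chi> i. if i = m then x $ m + x $ n else x $ i"
    have lin: "linear ?h" by (rule linearI) (auto simp: vec_eq_iff algebra_simps)
    have "matrix ?h = (\<chi> k. if k = m then row m (mat 1) + 1 *s row n (mat 1) else row k (mat 1))"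
      using mn by (simp add: matrix_def axis_def row_def mat_def vec_eq_iff)
    then have "det (matrix ?h) = 1" by (simp only: det_row_operation[OF mn] det_I)
    moreover have "measure lebesgue (?h ` cbox a b) = measure lebesgue (cbox a b)" for a b
    proof (cases "cbox a b = {}")
      case False
      \<comment> \<open>\<open>measure_shear_interval\<close> needs a box with lower bound nonnegative in direction \<open>n\<close>, which
        this translation provides.\<close>
      define t :: "real^'n" where "t = axis n (- (a $ n))"
      have "(+) (?h t) ` ?h ` cbox a b = ?h ` (+) t ` cbox a b"
        unfolding image_image linear_add[OF lin] ..
      also have "(+) t ` cbox a b = cbox (t + a) (t + b)"
        by (simp add: cbox_translation)
      finally have "measure lebesgue (?h ` cbox a b) = measure lebesgue (?h ` cbox (t + a) (t + b))"
        using measure_translation[of "?h t" "?h ` cbox a b"] by simp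
      also have "\<dots> = measure lebesgue (cbox (t + a) (t + b))"
        by (rule measure_shear_interval[OF mn]) (use False in \<open>simp_all add: t_def cbox_translation\<close>)
      also have "\<dots> = measure lebesgue (cbox a b)"
        unfolding cbox_translation by (rule measure_translation)
      finally show ?thesis .
    qed simp
    ultimately show "scales ?h" using boxes[OF lin] by simp
  qed
  then show ?thesis using assms(2) by (simp add: scales_def)
qed

definition half_open_cell :: "real^'n^'n \<Rightarrow> (real^'n) set" where
  "half_open_cell v = (\<lambda>c. c v* v) ` half_open_cube"

lemma half_open_cell_measurable: "half_open_cell v \<in> lmeasurable"
  and measure_half_open_cell: "measure lebesgue (half_open_cell v) = \<bar>det v\<bar>"
proof -
  have eq: "half_open_cell v = (*v) (transpose v) ` half_open_cube"
    by (simp add: half_open_cell_def)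
  have lin: "linear ((*v) (transpose v))" by (rule matrix_vector_mul_linear)
  show "half_open_cell v \<in> lmeasurable"
    unfolding eq using measure_linear_image_cart[OF lin half_open_cube_measurable] by blast
  show "measure lebesgue (half_open_cell v) = \<bar>det v\<bar>"
    unfolding eq using measure_linear_image_cart[OF lin half_open_cube_measurable]
    by (simp only: matrix_of_matrix_vector_mul det_transpose measure_half_open_cube mult_1_right)
qed

lemma half_open_cell_cover:
  fixes v :: "real^'n^'n"
  assumes "det v \<noteq> 0"
  shows "\<exists>x\<in>int_span v. z \<in> (+) x ` half_open_cell v"
proof -
  obtain u where u: "u ** v = mat 1"
    using assms invertible_det_nz[of v] by (auto simp: invertible_def)
  define c where "c = z v* u"
  define k :: "real^'n" where "k = (\<chi> i. real_of_int \<lfloor>c $ i\<rfloor>)"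
  have "z = c v* v" by (simp add: c_def vector_matrix_mul_assoc u)
  then have "z = k v* v + (c - k) v* v" by (simp add: vector_matrix_mult_diff_distrib)
  moreover have "k v* v \<in> int_span v"
    unfolding int_span_eq_image k_def by (intro imageI int_vecs_floor)
  moreover have "(c - k) v* v \<in> half_open_cell v"
    unfolding half_open_cell_def k_def by (intro imageI half_open_cube_frac)
  ultimately show ?thesis by blast
qed

lemma half_open_cell_disjoint:
  assumes "det v \<noteq> 0" "x \<in> int_span v" "y \<in> int_span v" "x \<noteq> y"
  shows "(+) x ` half_open_cell v \<inter> (+) y ` half_open_cell v = {}"
proof (rule ccontr)
  assume "(+) x ` half_open_cell v \<inter> (+) y ` half_open_cell v \<noteq> {}"
  then obtain a b where ab: "a \<in> half_open_cube" "b \<in> half_open_cube" "x + a v* v = y + b v* v"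
    by (auto simp: half_open_cell_def)
  have "y - x \<in> int_span v" using assms int_span_diff by blast
  then obtain k where k: "k \<in> int_vecs" "y - x = k v* v" by (auto simp: int_span_eq_image)
  have "(a - b - k) v* v = 0"
    using ab(3) by (simp add: vector_matrix_mult_diff_distrib flip: k(2)) (simp add: algebra_simps)
  then have "a - b = k" using vector_matrix_mult_eq_0[OF assms(1), of "a - b - k"] by simp
  then have "a = b" using half_open_cube_unique[OF ab(1,2)] k by simp
  then show False using ab(3) assms(4) by simp
qed

text \<open>The half-open cell is both a packing and a covering set for its lattice; using it in the one or
  the other role in the volume comparison gives the next two lemmas.\<close>

lemma measure_le_det_of_disjoint_translates:
  assumes "det v \<noteq> 0" "P \<in> lmeasurable"
    and disj: "\<And>x y. \<lbrakk>x \<in> int_span v; y \<in> int_span v; x \<noteq> y\<rbrakk> \<Longrightarrow> (+) x ` P \<inter> (+) y ` P = {}"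
  shows "measure lebesgue P \<le> \<bar>det v\<bar>"
proof -
  have "measure lebesgue P \<le> measure lebesgue (half_open_cell v)"
  proof (rule packing_measure_le_covering_measure[OF countable_int_span[of v] assms(2) half_open_cell_measurable])
    show "P \<subseteq> (\<Union>x\<in>int_span v. (+) x ` half_open_cell v)"
      using half_open_cell_cover[OF assms(1)] by blast
    show "(+) (- x) ` P \<inter> (+) (- y) ` P = {}"
      if "x \<in> int_span v" "y \<in> int_span v" "x \<noteq> y" for x y
      using disj[OF int_span_minus int_span_minus, of x y] that by simp
  qed
  then show ?thesis by (simp add: measure_half_open_cell)
qed

lemma det_le_measure_of_covering_translates:
  assumes "det v \<noteq> 0" "S \<in> lmeasurable"
    and cover: "\<And>z. \<exists>x\<in>int_span v. z \<in> (+) x ` S"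
  shows "\<bar>det v\<bar> \<le> measure lebesgue S"
proof -
  have "measure lebesgue (half_open_cell v) \<le> measure lebesgue S"
  proof (rule packing_measure_le_covering_measure[OF countable_int_span[of v] half_open_cell_measurable assms(2)])
    show "half_open_cell v \<subseteq> (\<Union>x\<in>int_span v. (+) x ` S)" using cover by blast
    show "(+) (- x) ` half_open_cell v \<inter> (+) (- y) ` half_open_cell v = {}"
      if "x \<in> int_span v" "y \<in> int_span v" "x \<noteq> y" for x y
      using half_open_cell_disjoint[OF assms(1) int_span_minus int_span_minus, of x y] that by simp
  qed
  then show ?thesis by (simp add: measure_half_open_cell)
qed

text \<open>Cubes at integral offsets from each other are disjoint, so that such a union counts its index set.\<close>

lemma measure_Union_translated_cubes:
  assumes "finite Q"
  shows "(\<Union>q\<in>Q. (+) (r q) ` half_open_cube) \<in> lmeasurable"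
    and "measure lebesgue (\<Union>q\<in>Q. (+) (r q) ` half_open_cube) \<le> card Q"
    and "(\<And>p q. \<lbrakk>p \<in> Q; q \<in> Q; p \<noteq> q\<rbrakk> \<Longrightarrow> r p \<noteq> r q \<and> r p - r q \<in> int_vecs) \<Longrightarrow>
           measure lebesgue (\<Union>q\<in>Q. (+) (r q) ` half_open_cube) = card Q"
proof -
  let ?C = "\<lambda>q. (+) (r q) ` half_open_cube"
  have m: "?C q \<in> lmeasurable" and one: "measure lebesgue (?C q) = 1" for q
    by (simp_all add: measurable_translation half_open_cube_measurable measure_translation measure_half_open_cube)
  show "(\<Union>q\<in>Q. ?C q) \<in> lmeasurable" using assms m by (intro fmeasurable.finite_UN) auto
  show "measure lebesgue (\<Union>q\<in>Q. ?C q) \<le> card Q"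
    using measure_UNION_le[OF assms, of ?C lebesgue] m one by (simp add: fmeasurableD)
  assume r: "\<And>p q. \<lbrakk>p \<in> Q; q \<in> Q; p \<noteq> q\<rbrakk> \<Longrightarrow> r p \<noteq> r q \<and> r p - r q \<in> int_vecs"
  have "?C p \<inter> ?C q = {}" if pq: "p \<in> Q" "q \<in> Q" "p \<noteq> q" for p q
  proof (rule ccontr)
    assume "?C p \<inter> ?C q \<noteq> {}"
    then obtain a b where ab: "a \<in> half_open_cube" "b \<in> half_open_cube" "r p + a = r q + b" by auto
    then have "b - a = r p - r q" by (simp add: algebra_simps)
    then have "b = a" using half_open_cube_unique[OF ab(2,1)] r[OF pq] by simp
    then show False using ab r[OF pq] by simp
  qed
  then have "measure lebesgue (\<Union>q\<in>Q. ?C q) = (\<Sum>q\<in>Q. measure lebesgue (?C q))"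
    by (intro measure_UNION' assms m) (auto simp: pairwise_def disjnt_def)
  then show "measure lebesgue (\<Union>q\<in>Q. ?C q) = card Q" by (simp add: one)
qed

lemma measure_simplex: "measure lebesgue (\<triangle> :: (real^'n) set) = 1 / fact CARD('n)"
proof -
  have Basis: "(Basis :: (real^'n) set) = range (\<lambda>i. axis i 1)" by (auto simp: Basis_vec_def)
  have "inj (\<lambda>i :: 'n. axis i (1 :: real))" by (auto simp: inj_on_def axis_eq_axis)
  then have "sum ((\<bullet>) x) Basis = (\<Sum>i\<in>UNIV. x $ i)" for x :: "real^'n"
    unfolding Basis by (simp add: sum.reindex cart_eq_inner_axis)
  then have "(\<triangle> :: (real^'n) set) = convex hull (insert 0 Basis)"
    unfolding std_simplex simplex_body_def by (simp add: Basis cart_eq_inner_axis)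
  moreover have "compact (convex hull (insert 0 Basis) :: (real^'n) set)"
    by (intro finite_imp_compact_convex_hull) auto
  ultimately show ?thesis using content_std_simplex[where 'a = "real^'n"]
    by (simp add: measure_completion borel_compact)
qed

section \<open>Index tuples and integer points of the dilated simplex\<close>

text \<open>The vertices of the simplex, numbered so that the origin has index \<open>0\<close> and corresponds to the
  element \<open>b\<^sub>0\<close> that is subtracted; \<open>e\<close> numbers the coordinates from \<open>1\<close> to \<open>n\<close>.\<close>

definition vertex :: "(nat \<Rightarrow> 'n) \<Rightarrow> nat \<Rightarrow> real^'n" where
  "vertex e k = (if k = 0 then 0 else axis (e k) 1)"

definition tuple_vec :: "(nat \<Rightarrow> 'n) \<Rightarrow> nat \<Rightarrow> (nat \<Rightarrow> nat) \<Rightarrow> real^'n::finite" where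
  "tuple_vec e h i = (\<Sum>j\<in>{1..h}. vertex e (i j))"

definition int_simplex :: "nat \<Rightarrow> (real^'n) set" where
  "int_simplex h = {u \<in> int_vecs. (\<forall>i. 0 \<le> u $ i) \<and> (\<Sum>i\<in>UNIV. u $ i) \<le> real h}"

definition tuple_mset :: "nat \<Rightarrow> (nat \<Rightarrow> nat) \<Rightarrow> nat multiset" where
  "tuple_mset h i = image_mset i (mset_set {1..h})"

lemma tuple_mset_eq_mset: "tuple_mset h i = mset (map i [1..<Suc h])"
proof -
  have "mset_set {1..h} = mset [1..<Suc h]"
    by (simp only: mset_upt atLeastLessThanSuc_atLeastAtMost)
  then show ?thesis by (simp add: tuple_mset_def)
qed

lemma vertex_in_int_vecs: "vertex e k \<in> int_vecs"
  by (auto simp: vertex_def int_vecs_def axis_def)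

lemma tuple_mset_props:
  assumes "i \<in> index_tuples h n"
  shows "\<And>j. j \<in> {1..h} \<Longrightarrow> i j \<le> n" "set_mset (tuple_mset h i) \<subseteq> {0..n}" "size (tuple_mset h i) = h"
proof -
  show 1: "i j \<le> n" if "j \<in> {1..h}" for j using assms that by (auto simp: index_tuples_def)
  then show "set_mset (tuple_mset h i) \<subseteq> {0..n}" by (auto simp: tuple_mset_def)
  show "size (tuple_mset h i) = h" by (simp add: tuple_mset_def)
qed

text \<open>The coordinates of \<open>tuple_vec e h i\<close> count how often the indices \<open>1, \<dots>, n\<close> occur in the tuple.
  The index \<open>0\<close> leaves no trace but its multiplicity is recovered from the total length \<open>h\<close>.\<close>

lemma tuple_vec_nth:
  assumes e: "bij_betw e {1..n} (UNIV :: 'n::finite set)" and k: "k \<in> {1..n}"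
    and i: "i \<in> index_tuples h n"
  shows "tuple_vec e h i $ e k = real (count (tuple_mset h i) k)"
proof -
  have "vertex e (i j) $ e k = (if i j = k then 1 else 0)" if "j \<in> {1..h}" for j
  proof (cases "i j = 0")
    case False
    then have "e k = e (i j) \<longleftrightarrow> k = i j"
      using inj_on_eq_iff[of e "{1..n}" k "i j"] e k tuple_mset_props(1)[OF i that] by (simp add: bij_betw_def)
    then show ?thesis using False by (auto simp: vertex_def axis_def)
  qed (use k in \<open>auto simp: vertex_def\<close>)
  then have "tuple_vec e h i $ e k = (\<Sum>j\<in>{1..h}. if i j = k then 1 else 0)"
    by (simp add: tuple_vec_def)
  also have "\<dots> = real (card {j\<in>{1..h}. i j = k})"
    by (simp add: sum.If_cases Int_def)
  finally show ?thesis by (simp add: tuple_mset_def count_image_mset_eq_card_vimage)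
qed

lemma size_eq_sum_count:
  fixes M :: "nat multiset"
  assumes "set_mset M \<subseteq> {0..n}"
  shows "size M = count M 0 + (\<Sum>k\<in>{1..n}. count M k)"
proof -
  have "size M = (\<Sum>k\<in>{0..n}. count M k)"
    unfolding size_multiset_overloaded_eq using assms
    by (intro sum.mono_neutral_left) (auto simp: count_eq_zero_iff)
  then show ?thesis by (simp add: sum.atLeast_Suc_atMost)
qed

lemma sum_tuple_vec:
  assumes e: "bij_betw e {1..n} (UNIV :: 'n::finite set)" and i: "i \<in> index_tuples h n"
  shows "(\<Sum>m\<in>UNIV. tuple_vec e h i $ m) + real (count (tuple_mset h i) 0) = real h"
proof -
  have "(\<Sum>m\<in>UNIV. tuple_vec e h i $ m) = (\<Sum>k\<in>{1..n}. tuple_vec e h i $ e k)"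
    by (rule sum.reindex_bij_betw[OF e, symmetric])
  also have "\<dots> = (\<Sum>k\<in>{1..n}. real (count (tuple_mset h i) k))"
    by (intro sum.cong refl tuple_vec_nth[OF e] i)
  finally show ?thesis
    using size_eq_sum_count[OF tuple_mset_props(2)[OF i]] tuple_mset_props(3)[OF i]
    by (simp flip: of_nat_sum of_nat_add)
qed

lemma tuple_vec_in_int_simplex:
  assumes e: "bij_betw e {1..n} (UNIV :: 'n::finite set)" and i: "i \<in> index_tuples h n"
  shows "tuple_vec e h i \<in> int_simplex h"
proof -
  have "tuple_vec e h i $ m \<in> \<int> \<and> 0 \<le> tuple_vec e h i $ m" for m
  proof -
    obtain k where k: "k \<in> {1..n}" "m = e k" using e by (metis UNIV_I bij_betw_def image_iff)
    show ?thesis unfolding k(2) tuple_vec_nth[OF e k(1) i] by simp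
  qed
  then show ?thesis using sum_tuple_vec[OF assms] by (simp add: int_simplex_def int_vecs_def)
qed

text \<open>A monotone tuple is the sorted list of its entries, hence determined by their multiset.\<close>

lemma inj_on_tuple_mset: "inj_on (tuple_mset h) (index_tuples h n)"
proof (rule inj_onI)
  fix i i' assume i: "i \<in> index_tuples h n" and i': "i' \<in> index_tuples h n"
    and eq: "tuple_mset h i = tuple_mset h i'"
  have sorted: "sorted (map i [1..<Suc h])" if "i \<in> index_tuples h n" for i
    using that by (auto simp: index_tuples_def sorted_iff_nth_mono mono_on_def simp del: upt_Suc)
  have "map i [1..<Suc h] = map i' [1..<Suc h]"
    using eq sorted[OF i] sorted[OF i'] unfolding tuple_mset_eq_mset
    by (metis properties_for_sort)
  then have "i j = i' j" if "j \<in> {1..h}" for j using that by (auto simp del: upt_Suc)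
  moreover have "i \<in> {1..h} \<rightarrow>\<^sub>E {0..n}" "i' \<in> {1..h} \<rightarrow>\<^sub>E {0..n}"
    using i i' by (simp_all only: index_tuples_def mem_Collect_eq)
  ultimately show "i = i'" by (rule PiE_ext[rotated 2])
qed

lemma tuple_mset_surj:
  assumes "set_mset M \<subseteq> {0..n}" "size M = h"
  shows "\<exists>i\<in>index_tuples h n. tuple_mset h i = M"
proof -
  define xs where "xs = sorted_list_of_multiset M"
  have xs: "sorted xs" "mset xs = M" by (simp_all add: xs_def)
  then have len: "length xs = h" and set: "set xs \<subseteq> {0..n}" using assms by auto
  define i where "i = (\<lambda>j\<in>{1..h}. xs ! (j - 1))"
  have nth: "xs ! (j - 1) \<in> {0..n}" if "j \<in> {1..h}" for j
    using that len by (intro subsetD[OF set] nth_mem) auto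
  have "i \<in> index_tuples h n"
    unfolding index_tuples_def
  proof (intro CollectI conjI)
    show "i \<in> {1..h} \<rightarrow>\<^sub>E {0..n}" using nth by (auto simp: i_def)
    show "mono_on {1..h} i"
      using xs(1) len by (auto simp: mono_on_def i_def sorted_iff_nth_mono)
  qed
  moreover have "map i [1..<Suc h] = xs"
    by (rule nth_equalityI) (auto simp: len i_def simp del: upt_Suc)
  then have "tuple_mset h i = M" by (simp add: tuple_mset_eq_mset xs(2) del: upt_Suc)
  ultimately show ?thesis by blast
qed

text \<open>Multisets of size \<open>h\<close> over \<open>{0..n}\<close> correspond to monotone tuples by sorting, and to integer
  points of the dilated simplex by taking the multiplicities of \<open>1, \<dots>, n\<close>.\<close>

lemma bij_betw_tuple_vec:
  assumes e: "bij_betw e {1..n} (UNIV :: 'n::finite set)"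
  shows "bij_betw (tuple_vec e h) (index_tuples h n) (int_simplex h)"
  unfolding bij_betw_def
proof (intro conjI subset_antisym subsetI)
  show "inj_on (tuple_vec e h) (index_tuples h n)"
  proof (rule inj_onI)
    fix i i' assume i: "i \<in> index_tuples h n" and i': "i' \<in> index_tuples h n"
      and eq: "tuple_vec e h i = tuple_vec e h i'"
    have "tuple_mset h i = tuple_mset h i'"
    proof (rule multiset_eqI)
      fix k
      consider "k = 0" | "k \<in> {1..n}" | "k > n" by force
      then show "count (tuple_mset h i) k = count (tuple_mset h i') k"
      proof cases
        case 1
        then show ?thesis using sum_tuple_vec[OF e i] sum_tuple_vec[OF e i'] eq by simp
      next
        case 2
        then show ?thesis
          using tuple_vec_nth[OF e 2 i] tuple_vec_nth[OF e 2 i'] eq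
          by simp
      next
        case 3
        then have "k \<notin># tuple_mset h i" "k \<notin># tuple_mset h i'"
          using tuple_mset_props(2)[OF i] tuple_mset_props(2)[OF i'] by auto
        then show ?thesis by (simp add: not_in_iff)
      qed
    qed
    then show "i = i'" using i i' inj_on_tuple_mset by (auto dest: inj_onD)
  qed
next
  fix u assume "u \<in> tuple_vec e h ` index_tuples h n"
  then show "u \<in> int_simplex h" using tuple_vec_in_int_simplex[OF e] by blast
next
  fix u :: "real^'n" assume u: "u \<in> int_simplex h"
  define s where "s = (\<Sum>k\<in>{1..n}. nat \<lfloor>u $ e k\<rfloor>)"
  have unat: "real (nat \<lfloor>u $ m\<rfloor>) = u $ m" for m
    using u by (auto simp: int_simplex_def int_vecs_def elim!: allE[of _ m] Ints_cases)
  have "real s = (\<Sum>k\<in>{1..n}. u $ e k)" by (simp add: s_def unat)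
  also have "\<dots> = (\<Sum>m\<in>UNIV. u $ m)" by (rule sum.reindex_bij_betw[OF e])
  finally have s: "s \<le> h" using u by (simp add: int_simplex_def)
  define M where "M = replicate_mset (h - s) 0 + (\<Sum>k\<in>{1..n}. replicate_mset (nat \<lfloor>u $ e k\<rfloor>) k)"
  have count: "count M k = nat \<lfloor>u $ e k\<rfloor>" if "k \<in> {1..n}" for k
    using that by (simp add: M_def count_sum sum.delta)
  have "set_mset M \<subseteq> {0..n}"
    by (auto simp: M_def set_mset_sum split: if_splits)
  moreover have "count M 0 = h - s"
    by (simp add: M_def count_sum)
  ultimately have "size M = h"
    using size_eq_sum_count[of M n] count s by (simp add: s_def)
  then obtain i where i: "i \<in> index_tuples h n" "tuple_mset h i = M"
    using tuple_mset_surj \<open>set_mset M \<subseteq> {0..n}\<close> by blast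
  have "tuple_vec e h i $ m = u $ m" for m
  proof -
    obtain k where k: "k \<in> {1..n}" "m = e k" using e by (metis UNIV_I bij_betw_def image_iff)
    show ?thesis
      unfolding k(2) tuple_vec_nth[OF e k(1) i(1)] i(2) count[OF k(1)] unat ..
  qed
  then have "u = tuple_vec e h i" by (simp add: vec_eq_iff)
  then show "u \<in> tuple_vec e h ` index_tuples h n" using i(1) by blast
qed

text \<open>The positive and negative parts of an integer vector are again integral, so no point is lost
  between the real simplex and its integer points. This is why the lower bound holds for every
  \<open>h\<close> without an error term.\<close>

lemma diff_norm_le_iff_diff_int_simplex:
  assumes "x \<in> int_vecs"
  shows "diff_norm x \<le> real h \<longleftrightarrow> (\<exists>u\<in>int_simplex h. \<exists>u'\<in>int_simplex h. x = u - u')"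
proof
  assume le: "diff_norm x \<le> real h"
  define u u' where "u = (\<chi> i. max (x $ i) 0)" and "u' = (\<chi> i. max (- x $ i) 0)"
  have "u \<in> int_simplex h" "u' \<in> int_simplex h"
    using assms le by (auto simp: int_simplex_def u_def u'_def int_vecs_def diff_norm_eq_max)
      (auto simp: max_def)
  moreover have "x = u - u'" by (simp add: u_def u'_def vec_eq_iff max_def)
  ultimately show "\<exists>u\<in>int_simplex h. \<exists>u'\<in>int_simplex h. x = u - u'" by blast
next
  assume "\<exists>u\<in>int_simplex h. \<exists>u'\<in>int_simplex h. x = u - u'"
  then obtain u u' where u: "u \<in> int_simplex h" "u' \<in> int_simplex h" "x = u - u'" by blast
  have "(\<Sum>i\<in>UNIV. max (x $ i) 0) \<le> (\<Sum>i\<in>UNIV. u $ i)" "(\<Sum>i\<in>UNIV. max (- x $ i) 0) \<le> (\<Sum>i\<in>UNIV. u' $ i)"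
    using u by (auto intro!: sum_mono simp: int_simplex_def)
  then show "diff_norm x \<le> real h" using u by (simp add: diff_norm_eq_max int_simplex_def)
qed

section \<open>Sidon sets and homomorphisms from the integer vectors\<close>

definition int_vec_group :: "(real^'n) monoid" where
  "int_vec_group = \<lparr>carrier = int_vecs, mult = (+), one = 0\<rparr>"

lemma int_vec_group_simps [simp]:
  "carrier int_vec_group = int_vecs" "x \<otimes>\<^bsub>int_vec_group\<^esub> y = x + y" "\<one>\<^bsub>int_vec_group\<^esub> = 0"
  by (simp_all add: int_vec_group_def)

lemma comm_group_int_vec_group: "comm_group int_vec_group"
proof (rule comm_groupI)
  fix x :: "real^'n" assume "x \<in> carrier int_vec_group"
  then show "\<exists>y\<in>carrier int_vec_group. y \<otimes>\<^bsub>int_vec_group\<^esub> x = \<one>\<^bsub>int_vec_group\<^esub>"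
    by (intro bexI[of _ "- x"]) (simp_all add: int_vecs_minus)
qed (simp_all add: int_vecs_add ac_simps)

lemma hom_finprod_tuple:
  assumes "comm_group G" and \<psi>: "\<psi> \<in> hom int_vec_group G"
  shows "(\<Otimes>\<^bsub>G\<^esub>j\<in>{1..h}. \<psi> (vertex e (i j))) = \<psi> (tuple_vec e h i)"
proof -
  interpret G: comm_group G by fact
  have mem: "\<psi> x \<in> carrier G" if "x \<in> int_vecs" for x
    using \<psi> that by (auto simp: hom_def)
  have "\<psi> 0 \<otimes>\<^bsub>G\<^esub> \<psi> 0 = \<psi> 0" using \<psi> by (auto simp: hom_def dest!: bspec[of _ _ 0])
  then have zero: "\<psi> 0 = \<one>\<^bsub>G\<^esub>" using mem[of 0] by (simp add: G.r_cancel_one)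
  have "(\<Otimes>\<^bsub>G\<^esub>j\<in>A. \<psi> (vertex e (i j))) = \<psi> (\<Sum>j\<in>A. vertex e (i j)) \<and> (\<Sum>j\<in>A. vertex e (i j)) \<in> int_vecs"
    if "finite A" for A
    using that
  proof induction
    case empty
    then show ?case by (simp add: zero)
  next
    case (insert a A)
    then show ?case using \<psi> mem vertex_in_int_vecs[of e] int_vecs_add[of "vertex e (i a)"]
      by (simp add: hom_def)
  qed
  then show ?thesis by (simp add: tuple_vec_def)
qed

lemma int_vec_hom_diff_eq_one_iff:
  fixes \<psi> :: "real^'n \<Rightarrow> 'a"
  assumes "comm_group G" and \<psi>: "\<psi> \<in> hom int_vec_group G" and "x \<in> int_vecs" "y \<in> int_vecs"
  shows "\<psi> (x - y) = \<one>\<^bsub>G\<^esub> \<longleftrightarrow> \<psi> x = \<psi> y"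
proof -
  interpret G: comm_group G by fact
  have mem: "\<psi> x \<in> carrier G" if "x \<in> int_vecs" for x
    using \<psi> that by (auto simp: hom_def)
  have "\<psi> ((x - y) + y) = \<psi> (x - y) \<otimes>\<^bsub>G\<^esub> \<psi> y"
    using \<psi> assms(3,4) int_vecs_diff[OF assms(3,4)]
    by (simp only: hom_def mem_Collect_eq int_vec_group_simps)
  then show ?thesis
    using mem assms(3,4) int_vecs_diff[OF assms(3,4)]
    by (metis G.l_one G.right_cancel G.one_closed diff_add_cancel)
qed

text \<open>The differences of points of \<open>int_simplex h\<close> are the integer vectors with \<open>diff_norm\<close> at most
  \<open>h\<close>, so a collision of \<open>\<psi>\<close> on \<open>int_simplex h\<close> is the same thing as a short nonzero kernel vector.\<close>

lemma inj_on_int_simplex_iff: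
  fixes \<psi> :: "real^'n \<Rightarrow> 'a"
  assumes "comm_group G" and \<psi>: "\<psi> \<in> hom int_vec_group G"
  shows "inj_on \<psi> (int_simplex h) \<longleftrightarrow> (\<forall>x\<in>int_vecs. \<psi> x = \<one>\<^bsub>G\<^esub> \<longrightarrow> x \<noteq> 0 \<longrightarrow> real h < diff_norm x)"
proof -
  interpret G: comm_group G by fact
  note eq = int_vec_hom_diff_eq_one_iff[OF assms]
  have sub: "int_simplex h \<subseteq> int_vecs" by (auto simp: int_simplex_def)
  show ?thesis
  proof
    assume inj: "inj_on \<psi> (int_simplex h)"
    show "\<forall>x\<in>int_vecs. \<psi> x = \<one>\<^bsub>G\<^esub> \<longrightarrow> x \<noteq> 0 \<longrightarrow> real h < diff_norm x"
    proof (intro ballI impI, rule ccontr)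
      fix x :: "real^'n" assume x: "x \<in> int_vecs" "\<psi> x = \<one>\<^bsub>G\<^esub>" "x \<noteq> 0" "\<not> real h < diff_norm x"
      then obtain u u' where u: "u \<in> int_simplex h" "u' \<in> int_simplex h" "x = u - u'"
        using diff_norm_le_iff_diff_int_simplex[OF x(1), of h] by (auto simp: not_less)
      then have "\<psi> u = \<psi> u'" using eq x(2) sub by blast
      then show False using inj u x(3) by (auto dest: inj_onD)
    qed
  next
    assume far: "\<forall>x\<in>int_vecs. \<psi> x = \<one>\<^bsub>G\<^esub> \<longrightarrow> x \<noteq> 0 \<longrightarrow> real h < diff_norm x"
    show "inj_on \<psi> (int_simplex h)"
    proof (rule inj_onI, rule ccontr)
      fix u u' assume u: "u \<in> int_simplex h" "u' \<in> int_simplex h" "\<psi> u = \<psi> u'" "u \<noteq> u'"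
      then have int: "u \<in> int_vecs" "u' \<in> int_vecs" using sub by auto
      then have "real h < diff_norm (u - u')"
        using far eq[OF int] u int_vecs_diff[OF int] by auto
      then show False
        using diff_norm_le_iff_diff_int_simplex[OF int_vecs_diff[OF int], of h] u by auto
    qed
  qed
qed

text \<open>The construction behind the upper bound: a homomorphism without short kernel vectors maps the
  vertices of the simplex to a \<open>B\<^sub>h\<close> set. The condition \<open>h \<ge> 1\<close> makes the vertices themselves points
  of \<open>int_simplex h\<close>, so that their images are distinct.\<close>

lemma Bh_set_hom_image:
  assumes "comm_group G" and \<psi>: "\<psi> \<in> hom int_vec_group G"
    and e: "bij_betw e {1..n} (UNIV :: 'n::finite set)" and "h \<ge> 1"
    and far: "\<And>x :: real^'n. \<lbrakk>x \<in> int_vecs; \<psi> x = \<one>\<^bsub>G\<^esub>; x \<noteq> 0\<rbrakk> \<Longrightarrow> real h < diff_norm x"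
  shows "Bh_set G h n ((\<lambda>k. \<psi> (vertex e k)) ` {0..n})"
  unfolding Bh_set_def
proof (intro conjI exI)
  have inj: "inj_on \<psi> (int_simplex h)"
    using inj_on_int_simplex_iff[OF assms(1,2), of h] far by blast
  show "(\<lambda>k. \<psi> (vertex e k)) ` {0..n} \<subseteq> carrier G"
    using \<psi> vertex_in_int_vecs[of e] by (auto simp: hom_def)
  have "inj_on (vertex e) {0..n}"
  proof (rule inj_onI)
    fix k l assume "k \<in> {0..n}" "l \<in> {0..n}" "vertex e k = vertex e l"
    then show "k = l" using inj_on_eq_iff[of e "{1..n}" k l] e
      by (cases "k = 0"; cases "l = 0") (auto simp: vertex_def axis_eq_axis bij_betw_def)
  qed
  moreover have "vertex e ` {0..n} \<subseteq> int_simplex h"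
  proof
    fix u assume "u \<in> vertex e ` {0..n}"
    then obtain k where u: "u = vertex e k" by blast
    have "(\<Sum>i\<in>UNIV. u $ i) \<le> 1" "\<forall>i. 0 \<le> u $ i" unfolding u by (auto simp: vertex_def axis_def)
    then show "u \<in> int_simplex h" using u vertex_in_int_vecs \<open>h \<ge> 1\<close> by (auto simp: int_simplex_def)
  qed
  ultimately have "inj_on (\<psi> \<circ> vertex e) {0..n}"
    by (meson comp_inj_on inj inj_on_subset)
  then show "bij_betw (\<lambda>k. \<psi> (vertex e k)) {0..n} ((\<lambda>k. \<psi> (vertex e k)) ` {0..n})"
    by (simp add: bij_betw_def o_def)
  have "inj_on (\<psi> \<circ> tuple_vec e h) (index_tuples h n)"
    using bij_betw_tuple_vec[OF e, of h] inj by (simp add: bij_betw_def comp_inj_on)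
  then show "inj_on (\<lambda>i. \<Otimes>\<^bsub>G\<^esub>j\<in>{1..h}. \<psi> (vertex e (i j))) (index_tuples h n)"
    unfolding hom_finprod_tuple[OF assms(1,2)] by (simp add: o_def)
qed

text \<open>Conversely, \<open>\<psi>\<close> sends the \<open>k\<close>-th vertex to the quotient of \<open>b k\<close> by \<open>b 0\<close>. A product over an
  index tuple then equals \<open>\<psi> (tuple_vec e h i)\<close> up to the constant factor \<open>b 0 ^ h\<close>, so distinct
  products mean that \<open>\<psi>\<close> is injective on \<open>int_simplex h\<close>.\<close>

lemma Bh_set_imp_hom:
  assumes "comm_group G" and B: "Bh_set G h n B"
    and e: "bij_betw e {1..n} (UNIV :: 'n::finite set)"
  shows "\<exists>\<psi>\<in>hom int_vec_group G. \<forall>x :: real^'n. x \<in> int_vecs \<longrightarrow> \<psi> x = \<one>\<^bsub>G\<^esub> \<longrightarrow> x \<noteq> 0 \<longrightarrow> real h < diff_norm x"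
proof -
  interpret G: comm_group G by fact
  obtain b where b: "bij_betw b {0..n} B" and BG: "B \<subseteq> carrier G"
    and inj: "inj_on (\<lambda>i. \<Otimes>\<^bsub>G\<^esub>j\<in>{1..h}. b (i j)) (index_tuples h n)"
    using B by (auto simp: Bh_set_def)
  have bG: "b k \<in> carrier G" if "k \<le> n" for k
    using that b BG by (auto simp: bij_betw_def)
  define d where "d k = b k \<otimes>\<^bsub>G\<^esub> inv\<^bsub>G\<^esub> b 0" for k
  have dG: "d k \<in> carrier G" if "k \<le> n" for k using bG that by (simp add: d_def)
  define k where "k = inv_into {1..n} e"
  have k: "k m \<in> {1..n}" "e (k m) = m" for m
    using e inv_into_into[of m e "{1..n}"] f_inv_into_f[of m e "{1..n}"] by (auto simp: k_def bij_betw_def)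
  have ke: "k (e l) = l" if "l \<in> {1..n}" for l
    using e that by (simp add: k_def bij_betw_def)
  define \<psi> where "\<psi> x = (\<Otimes>\<^bsub>G\<^esub>m\<in>UNIV. d (k m) [^]\<^bsub>G\<^esub> \<lfloor>x $ m\<rfloor>)" for x :: "real^'n"
  have pG: "d (k m) [^]\<^bsub>G\<^esub> (z :: int) \<in> carrier G" for m z
    using dG k(1)[of m] by (intro G.int_pow_closed) auto
  have hom: "\<psi> \<in> hom int_vec_group G"
  proof (rule homI)
    fix x y :: "real^'n" assume "x \<in> carrier int_vec_group" "y \<in> carrier int_vec_group"
    then have "\<lfloor>x $ m + y $ m\<rfloor> = \<lfloor>x $ m\<rfloor> + \<lfloor>y $ m\<rfloor>" for m
      by (auto simp: int_vecs_def elim!: allE[of _ m] Ints_cases simp flip: of_int_add)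
    then have "\<psi> (x + y) = (\<Otimes>\<^bsub>G\<^esub>m\<in>UNIV. d (k m) [^]\<^bsub>G\<^esub> \<lfloor>x $ m\<rfloor> \<otimes>\<^bsub>G\<^esub> d (k m) [^]\<^bsub>G\<^esub> \<lfloor>y $ m\<rfloor>)"
      using dG k(1) by (simp add: \<psi>_def G.int_pow_mult)
    also have "\<dots> = \<psi> x \<otimes>\<^bsub>G\<^esub> \<psi> y"
      unfolding \<psi>_def using pG by (intro G.finprod_multf) auto
    finally show "\<psi> (x \<otimes>\<^bsub>int_vec_group\<^esub> y) = \<psi> x \<otimes>\<^bsub>G\<^esub> \<psi> y" by simp
  qed (simp add: \<psi>_def pG G.finprod_closed)
  have \<psi>_vertex: "\<psi> (vertex e l) = d l" if "l \<le> n" for l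
  proof (cases "l = 0")
    case True
    then show ?thesis by (simp add: \<psi>_def vertex_def d_def bG)
  next
    case False
    then have l: "l \<in> {1..n}" using that by simp
    have "\<psi> (vertex e l) = (\<Otimes>\<^bsub>G\<^esub>m\<in>UNIV. if m = e l then d (k m) else \<one>\<^bsub>G\<^esub>)"
      unfolding \<psi>_def using False dG k(1)
      by (intro G.finprod_cong') (auto simp: vertex_def axis_def)
    also have "\<dots> = d (k (e l))"
      using dG k(1) by (intro G.finprod_singleton_swap) auto
    finally show ?thesis by (simp add: ke[OF l])
  qed
  have prod: "(\<Otimes>\<^bsub>G\<^esub>j\<in>{1..h}. b (i j)) = \<psi> (tuple_vec e h i) \<otimes>\<^bsub>G\<^esub> (b 0 [^]\<^bsub>G\<^esub> h)"
    if i: "i \<in> index_tuples h n" for i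
  proof -
    have le: "i j \<le> n" if "j \<in> {1..h}" for j using tuple_mset_props(1)[OF i that] .
    have "(\<Otimes>\<^bsub>G\<^esub>j\<in>{1..h}. b (i j)) = (\<Otimes>\<^bsub>G\<^esub>j\<in>{1..h}. \<psi> (vertex e (i j)) \<otimes>\<^bsub>G\<^esub> b 0)"
      using le bG dG by (intro G.finprod_cong') (auto simp: \<psi>_vertex d_def G.m_assoc)
    also have "\<dots> = (\<Otimes>\<^bsub>G\<^esub>j\<in>{1..h}. \<psi> (vertex e (i j))) \<otimes>\<^bsub>G\<^esub> (\<Otimes>\<^bsub>G\<^esub>j\<in>{1..h}. b 0)"
      using le bG dG by (intro G.finprod_multf) (auto simp: \<psi>_vertex)
    also have "(\<Otimes>\<^bsub>G\<^esub>j\<in>{1..h}. b 0) = b 0 [^]\<^bsub>G\<^esub> h" by (simp add: G.finprod_const bG)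
    finally show ?thesis unfolding hom_finprod_tuple[OF assms(1) hom] .
  qed
  have "inj_on \<psi> (int_simplex h)"
  proof (rule inj_onI)
    fix u u' assume u: "u \<in> int_simplex h" "u' \<in> int_simplex h" "\<psi> u = \<psi> u'"
    obtain i i' where i: "i \<in> index_tuples h n" "u = tuple_vec e h i"
        "i' \<in> index_tuples h n" "u' = tuple_vec e h i'"
      using u bij_betw_tuple_vec[OF e, of h] unfolding bij_betw_def by (metis imageE)
    then have "(\<Otimes>\<^bsub>G\<^esub>j\<in>{1..h}. b (i j)) = (\<Otimes>\<^bsub>G\<^esub>j\<in>{1..h}. b (i' j))"
      using u(3) by (simp only: prod)
    then have "i = i'" using inj i by (auto dest: inj_onD)
    then show "u = u'" using i by simp
  qed
  then show ?thesis using hom inj_on_int_simplex_iff[OF assms(1) hom, of h] by blast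
qed

section \<open>Index and determinant of an integral lattice\<close>

lemma int_vecs_scaleR_int: "x \<in> int_vecs \<Longrightarrow> k \<in> \<int> \<Longrightarrow> k *\<^sub>R x \<in> int_vecs"
  by (simp add: int_vecs_def)

lemma det_in_Ints:
  fixes w :: "real^'n^'n"
  assumes "\<And>i. w $ i \<in> int_vecs"
  shows "det w \<in> \<int>"
  unfolding det_def using assms by (intro Ints_sum Ints_mult Ints_prod) (auto simp: int_vecs_def)

lemma vector_matrix_mult_eq_sum: "c v* w = (\<Sum>i\<in>UNIV. c $ i *\<^sub>R (w $ i))"
  for w :: "real^'n^'m"
  by (simp add: vec_eq_iff vector_matrix_mult_def)

text \<open>Every subgroup of finite index of the integer vectors has a lattice basis. Among all systems of
  \<open>n\<close> independent vectors in \<open>L\<close> take one with least absolute determinant, a positive integer. If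
  some \<open>x \<in> L\<close> had a non-integral coordinate with respect to it, then replacing the corresponding
  basis vector by \<open>x\<close> minus its integral part would multiply the determinant by a number strictly
  between \<open>0\<close> and \<open>1\<close> (Cramer's rule). The multiples by \<open>N\<close> of the unit
  vectors are one such system, so the minimum exists.\<close>

lemma subgroup_int_span:
  fixes L :: "(real^'n) set"
  assumes sub: "L \<subseteq> int_vecs" and diff: "\<And>x y. \<lbrakk>x \<in> L; y \<in> L\<rbrakk> \<Longrightarrow> x - y \<in> L"
    and N: "N > 0" "\<And>x. x \<in> int_vecs \<Longrightarrow> real N *\<^sub>R x \<in> L"
  shows "\<exists>w :: real^'n^'n. det w \<noteq> 0 \<and> int_span w = L"
proof -
  have zero: "0 \<in> L" using N(2)[of 0] by simp
  have minus: "- x \<in> L" if "x \<in> L" for x using diff[OF zero that] by simp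
  have add: "x + y \<in> L" if "x \<in> L" "y \<in> L" for x y using diff[OF that(1) minus[OF that(2)]] by simp
  have nat_mult: "real m *\<^sub>R x \<in> L" if "x \<in> L" for m x
    using that by (induction m) (auto simp: zero add algebra_simps)
  have int_mult: "k *\<^sub>R x \<in> L" if "x \<in> L" "k \<in> \<int>" for k x
  proof -
    obtain z where "k = real_of_int z" using \<open>k \<in> \<int>\<close> by (auto elim: Ints_cases)
    then show ?thesis using nat_mult[OF that(1)] minus[OF nat_mult[OF that(1)]]
      by (cases z rule: int_cases2) auto
  qed
  have comb: "c v* w \<in> L" if "c \<in> int_vecs" "\<And>i. w $ i \<in> L" for c and w :: "real^'n^'n"
  proof -
    have step: "c $ i *\<^sub>R (w $ i) \<in> L" for i using that by (intro int_mult) (auto simp: int_vecs_def)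
    have "(\<Sum>i\<in>A. c $ i *\<^sub>R (w $ i)) \<in> L" if "finite A" for A
      using that by induction (auto intro!: zero add step)
    then show ?thesis by (simp add: vector_matrix_mult_eq_sum)
  qed
  define P where "P m \<longleftrightarrow> (\<exists>w :: real^'n^'n. (\<forall>i. w $ i \<in> L) \<and> det w \<noteq> 0 \<and> \<bar>det w\<bar> = real m)" for m
  have ex_abs: "\<exists>m. \<bar>det w\<bar> = real m" if "\<And>i. w $ i \<in> L" for w :: "real^'n^'n"
  proof -
    have "det w \<in> \<int>" using det_in_Ints[of w] that sub by blast
    then obtain z where "det w = real_of_int z" by (auto elim: Ints_cases)
    then show ?thesis by (intro exI[of _ "nat \<bar>z\<bar>"]) simp
  qed
  let ?D = "(\<chi> i. real N *\<^sub>R axis i 1) :: real^'n^'n"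
  have "det ?D \<noteq> 0"
    by (subst det_diagonal) (use N(1) in \<open>auto simp: axis_def\<close>)
  moreover have "?D $ i \<in> L" for i by (simp add: N(2) int_vecs_def axis_def)
  ultimately have "\<exists>m. P m" unfolding P_def using ex_abs[of ?D] by blast
  then have "P (LEAST m. P m)" by (rule LeastI_ex)
  then obtain w :: "real^'n^'n" where w: "\<And>i. w $ i \<in> L" "det w \<noteq> 0" "\<bar>det w\<bar> = real (LEAST m. P m)"
    unfolding P_def by blast
  have least: "\<bar>det w\<bar> \<le> \<bar>det w'\<bar>" if w': "\<And>i. w' $ i \<in> L" "det w' \<noteq> 0" for w' :: "real^'n^'n"
  proof -
    obtain m where m: "\<bar>det w'\<bar> = real m" using ex_abs[of w'] w'(1) by blast
    then have "P m" using w' unfolding P_def by blast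
    then show ?thesis using m w(3) by (simp add: Least_le)
  qed
  have "int_span w = L"
  proof (intro subset_antisym subsetI)
    fix x assume "x \<in> int_span w"
    then show "x \<in> L" using comb w(1) by (auto simp: int_span_eq_image)
  next
    fix x assume x: "x \<in> L"
    obtain u where u: "u ** w = mat 1"
      using w(2) invertible_det_nz[of w] by (auto simp: invertible_def)
    define c where "c = x v* u"
    define k :: "real^'n" where "k = (\<chi> i. real_of_int \<lfloor>c $ i\<rfloor>)"
    have xc: "x = c v* w" by (simp add: c_def vector_matrix_mul_assoc u)
    have k: "k \<in> int_vecs" by (simp add: k_def int_vecs_floor)
    have y: "(c - k) v* w \<in> L"
      unfolding vector_matrix_mult_diff_distrib xc[symmetric] using diff[OF x comb[OF k w(1)]] .
    have frac: "c - k \<in> half_open_cube" unfolding k_def by (rule half_open_cube_frac)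
    have "(c - k) $ i = 0" for i
    proof (rule ccontr)
      assume nz: "(c - k) $ i \<noteq> 0"
      define w' where "w' = (\<chi> l. if l = i then (c - k) v* w else w $ l)"
      have "w' = (\<chi> l. if l = i then sum (\<lambda>i. (c - k) $ i *s row i w) UNIV else row l w)"
        by (auto simp: w'_def vector_matrix_mult_eq_sum row_def vec_eq_iff left_diff_distrib)
      then have det: "det w' = (c - k) $ i * det w" by (simp only: cramer_lemma_transpose)
      have "w' $ l \<in> L" for l using y w(1) by (simp add: w'_def)
      then have "1 * \<bar>det w\<bar> \<le> \<bar>(c - k) $ i\<bar> * \<bar>det w\<bar>"
        using least[of w'] det nz w(2) by (simp add: abs_mult)
      then have "1 \<le> \<bar>(c - k) $ i\<bar>" using w(2) by (simp only: mult_le_cancel_right)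
      then show False using frac by (auto simp: half_open_cube_def dest!: spec[of _ i])
    qed
    then have "c = k" by (simp add: vec_eq_iff)
    then show "x \<in> int_span w" using xc k by (auto simp: int_span_eq_image)
  qed
  then show ?thesis using w(2) by blast
qed

text \<open>Unit cubes at representatives of the fibres of \<open>\<psi>\<close> cover the space when translated by the
  kernel, so the determinant of the kernel is at most the number of fibres.\<close>

lemma hom_kernel_lattice:
  assumes "comm_group G" "finite (carrier G)" and \<psi>: "\<psi> \<in> hom int_vec_group G"
  shows "\<exists>w :: real^'n^'n. det w \<noteq> 0 \<and> int_span w = {x \<in> int_vecs. \<psi> x = \<one>\<^bsub>G\<^esub>} \<and> \<bar>det w\<bar> \<le> real (order G)"
proof -
  interpret G: comm_group G by fact
  interpret Z: comm_group "int_vec_group :: (real^'n) monoid" by (rule comm_group_int_vec_group)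
  interpret \<psi>: group_hom int_vec_group G \<psi>
    using \<psi> by unfold_locales
  have mem: "\<psi> x \<in> carrier G" if "x \<in> int_vecs" for x using \<psi>.hom_closed[of x] that by simp
  have add: "\<psi> (x + y) = \<psi> x \<otimes>\<^bsub>G\<^esub> \<psi> y" if "x \<in> int_vecs" "y \<in> int_vecs" for x y
    using \<psi>.hom_mult[of x y] that by simp
  note eq = int_vec_hom_diff_eq_one_iff[OF assms(1) \<psi>]
  have zero: "\<psi> 0 = \<one>\<^bsub>G\<^esub>" using \<psi>.hom_one by simp
  let ?L = "{x \<in> int_vecs. \<psi> x = \<one>\<^bsub>G\<^esub>}"
  have pow: "\<psi> (real m *\<^sub>R x) = \<psi> x [^]\<^bsub>G\<^esub> m" if "x \<in> int_vecs" for m x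
  proof (induction m)
    case (Suc m)
    have "real m *\<^sub>R x \<in> int_vecs" using that by (intro int_vecs_scaleR_int) auto
    then show ?case using Suc add[of "real m *\<^sub>R x" x] that by (simp add: algebra_simps)
  qed (simp add: zero)
  have "\<exists>w :: real^'n^'n. det w \<noteq> 0 \<and> int_span w = ?L"
  proof (rule subgroup_int_span[where N = "order G"])
    show "x - y \<in> ?L" if "x \<in> ?L" "y \<in> ?L" for x y
      using that eq[of x y] by (simp add: int_vecs_diff)
    show "order G > 0" using assms(2) by (simp add: G.order_gt_0_iff_finite)
    show "real (order G) *\<^sub>R x \<in> ?L" if "x \<in> int_vecs" for x
      using that pow[OF that] mem assms(2)
      by (simp add: int_vecs_scaleR_int order_def G.power_order_eq_one)
  qed blast
  then obtain w :: "real^'n^'n" where w: "det w \<noteq> 0" "int_span w = ?L" by blast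
  define Q where "Q = \<psi> ` (int_vecs :: (real^'n) set)"
  have QG: "Q \<subseteq> carrier G" using mem by (auto simp: Q_def)
  then have fin: "finite Q" using assms(2) finite_subset by blast
  define r where "r q = (SOME x. x \<in> int_vecs \<and> \<psi> x = q)" for q
  have r: "r q \<in> int_vecs" "\<psi> (r q) = q" if "q \<in> Q" for q
    using that someI_ex[of "\<lambda>x. x \<in> int_vecs \<and> \<psi> x = q"] by (auto simp: Q_def r_def)
  have "\<bar>det w\<bar> \<le> measure lebesgue (\<Union>q\<in>Q. (+) (r q) ` half_open_cube)"
  proof (rule det_le_measure_of_covering_translates[OF w(1) measure_Union_translated_cubes(1)[OF fin]])
    fix z :: "real^'n"
    define k :: "real^'n" where "k = (\<chi> i. real_of_int \<lfloor>z $ i\<rfloor>)"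
    have k: "k \<in> int_vecs" by (simp add: k_def int_vecs_floor)
    then have q: "\<psi> k \<in> Q" by (simp add: Q_def)
    have "k - r (\<psi> k) \<in> int_span w"
      unfolding w(2) using k r[OF q] eq[OF k r(1)[OF q]] by (simp add: int_vecs_diff)
    moreover have "z = (k - r (\<psi> k)) + (r (\<psi> k) + (z - k))" by simp
    moreover have "z - k \<in> half_open_cube" unfolding k_def by (rule half_open_cube_frac)
    ultimately show "\<exists>x\<in>int_span w. z \<in> (+) x ` (\<Union>q\<in>Q. (+) (r q) ` half_open_cube)"
      using q by blast
  qed
  also have "\<dots> \<le> card Q" by (rule measure_Union_translated_cubes(2)[OF fin])
  also have "\<dots> \<le> order G" unfolding order_def using QG assms(2) by (simp add: card_mono)
  finally show ?thesis using w by blast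
qed

text \<open>Here the cubes sit at representatives of cosets. Their translates by the lattice are disjoint,
  which bounds the number of cosets by the determinant; finiteness of the quotient follows because
  this bound applies to every finite set of cosets.\<close>

lemma quotient_by_int_span:
  fixes w :: "real^'n^'n"
  assumes w: "det w \<noteq> 0" "\<And>i. w $ i \<in> int_vecs"
  defines "G \<equiv> int_vec_group Mod (int_span w)"
  defines "\<psi> \<equiv> \<lambda>x. int_span w #>\<^bsub>int_vec_group\<^esub> x"
  shows "comm_group G" "finite (carrier G)" "real (order G) \<le> \<bar>det w\<bar>"
    and "\<psi> \<in> hom int_vec_group G" "\<And>x. x \<in> int_vecs \<Longrightarrow> \<psi> x = \<one>\<^bsub>G\<^esub> \<longleftrightarrow> x \<in> int_span w"
proof -
  interpret Z: comm_group "int_vec_group :: (real^'n) monoid" by (rule comm_group_int_vec_group)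
  have sub: "int_span w \<subseteq> int_vecs"
  proof
    fix x assume "x \<in> int_span w"
    then obtain c where "c \<in> int_vecs" "x = c v* w" by (auto simp: int_span_eq_image)
    then show "x \<in> int_vecs" using w(2)
      by (auto simp: vector_matrix_mult_def int_vecs_def intro!: Ints_sum Ints_mult)
  qed
  have inv: "inv\<^bsub>int_vec_group\<^esub> x = - x" if "x \<in> int_vecs" for x :: "real^'n"
    using that by (intro Z.inv_equality) (auto simp: int_vecs_minus)
  have subgroup: "subgroup (int_span w) int_vec_group"
  proof (rule Z.subgroupI)
    show "int_span w \<noteq> {}" using int_span_0 by blast
    fix a b assume ab: "a \<in> int_span w" "b \<in> int_span w"
    then show "a \<otimes>\<^bsub>int_vec_group\<^esub> b \<in> int_span w"
      using int_span_diff[OF ab(1) int_span_minus[OF ab(2)]] by simp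
    have "a \<in> int_vecs" using ab(1) sub by blast
    then show "inv\<^bsub>int_vec_group\<^esub> a \<in> int_span w" using inv int_span_minus[OF ab(1)] by simp
  qed (use sub in auto)
  then interpret N: normal "int_span w" "int_vec_group" by (simp add: Z.normal_iff_subgroup)
  show comm: "comm_group G" unfolding G_def by (rule Z.abelian_FactGroup[OF subgroup])
  show "\<psi> \<in> hom int_vec_group G" unfolding \<psi>_def G_def by (rule N.r_coset_hom_Mod)
  have coset: "\<psi> x = \<psi> y \<longleftrightarrow> x - y \<in> int_span w" if "x \<in> int_vecs" "y \<in> int_vecs" for x y
  proof -
    have "\<psi> x = \<psi> y \<longleftrightarrow> x \<in> int_span w #>\<^bsub>int_vec_group\<^esub> y"
      unfolding \<psi>_def using that Z.repr_independence[OF _ _ subgroup, of x y] Z.rcos_self[OF _ subgroup, of x] by auto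
    also have "\<dots> \<longleftrightarrow> x - y \<in> int_span w"
      by (auto simp: r_coset_def algebra_simps intro: bexI[of _ "x - y"])
    finally show ?thesis .
  qed
  have one: "\<psi> 0 = \<one>\<^bsub>G\<^esub>" using Z.coset_mult_one[of "int_span w"] sub by (simp add: \<psi>_def G_def)
  show "\<psi> x = \<one>\<^bsub>G\<^esub> \<longleftrightarrow> x \<in> int_span w" if "x \<in> int_vecs" for x
    using coset[OF that int_vecs_0] by (simp add: one)
  have carG: "carrier G = \<psi> ` int_vecs" by (auto simp: G_def FactGroup_def RCOSETS_def \<psi>_def)
  have bound: "card Q \<le> nat \<lfloor>\<bar>det w\<bar>\<rfloor>" if Q: "Q \<subseteq> carrier G" "finite Q" for Q
  proof -
    define r where "r q = (SOME x. x \<in> int_vecs \<and> \<psi> x = q)" for q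
    have r: "r q \<in> int_vecs" "\<psi> (r q) = q" if "q \<in> Q" for q
      using that Q someI_ex[of "\<lambda>x. x \<in> int_vecs \<and> \<psi> x = q"] by (auto simp: carG r_def)
    let ?P = "\<Union>q\<in>Q. (+) (r q) ` (half_open_cube :: (real^'n) set)"
    have "measure lebesgue ?P = real (card Q)"
    proof (rule measure_Union_translated_cubes(3)[OF Q(2)])
      fix p q assume "p \<in> Q" "q \<in> Q" "p \<noteq> q"
      then show "r p \<noteq> r q \<and> r p - r q \<in> int_vecs" using r int_vecs_diff by metis
    qed
    moreover have "measure lebesgue ?P \<le> \<bar>det w\<bar>"
    proof (rule measure_le_det_of_disjoint_translates[OF w(1) measure_Union_translated_cubes(1)[OF Q(2)]])
      fix x y assume xy: "x \<in> int_span w" "y \<in> int_span w" "x \<noteq> y"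
      show "(+) x ` ?P \<inter> (+) y ` ?P = {}"
      proof (rule ccontr)
        assume "(+) x ` ?P \<inter> (+) y ` ?P \<noteq> {}"
        then obtain p q a b where pq: "p \<in> Q" "q \<in> Q" "a \<in> half_open_cube" "b \<in> half_open_cube"
          and eq: "x + (r p + a) = y + (r q + b)" by fast
        have ab: "a - b = (y - x) + (r q - r p)" using eq by (simp add: algebra_simps)
        have "a - b \<in> int_vecs"
          unfolding ab using xy pq r sub by (intro int_vecs_add int_vecs_diff) auto
        then have [simp]: "a = b" using half_open_cube_unique pq by blast
        then have "r p - r q = y - x" using eq by (simp add: algebra_simps)
        then have "p = q" using coset[of "r p" "r q"] r pq xy int_span_diff by metis
        then show False using eq xy by simp
      qed
    qed
    ultimately have "real (card Q) \<le> \<bar>det w\<bar>" by simp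
    then show ?thesis by (simp add: le_nat_floor)
  qed
  show fin: "finite (carrier G)"
    using finite_if_finite_subsets_card_bdd[of "carrier G"] bound by metis
  have "order G \<le> nat \<lfloor>\<bar>det w\<bar>\<rfloor>" using bound[OF order_refl fin] by (simp add: order_def)
  then show "real (order G) \<le> \<bar>det w\<bar>" by linarith
qed

text \<open>The predicate whose least witness is \<open>\<phi> h n\<close>. To use an actual group of order \<open>\<phi> h n\<close> one needs
  to know that it holds for some \<open>m\<close>, which the construction for the upper bound provides.\<close>

definition is_Bh_order :: "nat \<Rightarrow> nat \<Rightarrow> nat \<Rightarrow> bool" where
  "is_Bh_order h n m \<longleftrightarrow> (\<exists>G :: nat monoid. comm_group G \<and> finite (carrier G) \<and> order G = m \<and> (\<exists>B. Bh_set G h n B))"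

text \<open>Transport of the group structure to the naturals along an injection.\<close>

lemma is_Bh_order_order:
  fixes G :: "('a, 'c) monoid_scheme"
  assumes "comm_group G" "finite (carrier G)" "Bh_set G h n B"
  shows "is_Bh_order h n (order G)"
proof -
  interpret G: comm_group G by fact
  obtain f :: "'a \<Rightarrow> nat" where f: "inj_on f (carrier G)"
    using finite_imp_inj_to_nat_seg[OF assms(2)] by blast
  define H where "H = image_group f G"
  have iso: "f \<in> iso G H" unfolding H_def by (rule inj_imp_image_group_iso[OF f])
  have "group H" unfolding H_def by (rule G.inj_imp_image_group_is_group[OF f])
  then have H: "comm_group H"
    using G.iso_imp_comm_group[of H] iso by (auto simp: is_iso_def group.is_monoid)
  have car: "carrier H = f ` carrier G" by (simp add: H_def image_group_carrier)
  have "finite (carrier H)" "order H = order G"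
    using assms(2) f by (auto simp: car order_def card_image)
  then show ?thesis
    unfolding is_Bh_order_def using H Bh_set_iso[OF assms(1) H iso assms(3)] by blast
qed

section \<open>From integral matrices to bounds for the group order\<close>

lemma Bh_order_is_Bh_order: "is_Bh_order h n m \<Longrightarrow> is_Bh_order h n (\<phi> h n)"
  unfolding Bh_order_def is_Bh_order_def by (rule LeastI)

lemma Bh_order_le_det:
  fixes w :: "real^'n^'n"
  assumes "h \<ge> 1" "det w \<noteq> 0" "\<And>i. w $ i \<in> int_vecs"
    and far: "\<And>c. c \<in> int_vecs \<Longrightarrow> c \<noteq> 0 \<Longrightarrow> real h < diff_norm (c v* w)"
  shows "is_Bh_order h CARD('n) (\<phi> h CARD('n))" "real (\<phi> h CARD('n)) \<le> \<bar>det w\<bar>"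
proof -
  define G where "G = int_vec_group Mod (int_span w)"
  define \<psi> where "\<psi> = (\<lambda>x. int_span w #>\<^bsub>int_vec_group\<^esub> x)"
  note G = quotient_by_int_span[OF assms(2,3), folded G_def \<psi>_def]
  obtain e :: "nat \<Rightarrow> 'n" where e: "bij_betw e {1..CARD('n)} UNIV"
    using ex_bij_betw_nat_finite_1[of "UNIV :: 'n set"] by auto
  have "Bh_set G h CARD('n) ((\<lambda>k. \<psi> (vertex e k)) ` {0..CARD('n)})"
  proof (rule Bh_set_hom_image[OF G(1,4) e assms(1)])
    fix x assume "x \<in> int_vecs" "\<psi> x = \<one>\<^bsub>G\<^esub>" "x \<noteq> 0"
    then obtain c where "c \<in> int_vecs" "x = c v* w" using G(5) by (auto simp: int_span_eq_image)
    moreover have "c \<noteq> 0" using calculation \<open>x \<noteq> 0\<close> by auto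
    ultimately show "real h < diff_norm x" using far by simp
  qed
  then have "is_Bh_order h CARD('n) (order G)" "\<phi> h CARD('n) \<le> order G"
    using is_Bh_order_order[OF G(1,2)] Bh_order_le[OF G(1,2)] by blast+
  then show "is_Bh_order h CARD('n) (\<phi> h CARD('n))" "real (\<phi> h CARD('n)) \<le> \<bar>det w\<bar>"
    using G(3) Bh_order_is_Bh_order by auto
qed

definition round_matrix :: "real \<Rightarrow> real^'n^'n \<Rightarrow> real^'n^'n" where
  "round_matrix t v = (\<chi> i j. real_of_int \<lfloor>t * v $ i $ j\<rfloor>)"

lemma round_matrix_int_vecs: "round_matrix t v $ i \<in> int_vecs"
  by (simp add: round_matrix_def int_vecs_def)

text \<open>The error matrix \<open>E\<close> has entries of absolute value at most \<open>1\<close>, so it moves \<open>c v* (t *\<^sub>R v)\<close> by at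
  most a constant times \<open>l1_norm c\<close>; and \<open>l1_norm c\<close> is bounded by a multiple of
  \<open>diff_norm (c v* v)\<close> since \<open>v\<close> is invertible. The estimate holds for real \<open>c\<close>, hence it also yields
  the invertibility of the rounded matrix.\<close>

lemma diff_norm_round_matrix:
  fixes v :: "real^'n^'n"
  assumes "det v \<noteq> 0"
  shows "\<exists>C\<ge>0. \<forall>t\<ge>0. \<forall>c. (t - C) * diff_norm (c v* v) \<le> diff_norm (c v* round_matrix t v)"
proof -
  obtain u where u: "v ** u = mat 1"
    using assms invertible_det_nz[of v] by (auto simp: invertible_def)
  define M where "M = (\<Sum>i\<in>UNIV. l1_norm (u $ i))"
  define N where "N = real CARD('n) * real CARD('n)"
  have M: "0 \<le> M" by (simp add: M_def sum_nonneg l1_norm_nonneg)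
  have N: "0 \<le> N" by (simp add: N_def)
  have "(t - N * M * 2) * diff_norm (c v* v) \<le> diff_norm (c v* round_matrix t v)" if "t \<ge> 0" for t c
  proof -
    define E where "E = t *\<^sub>R v - round_matrix t v"
    have "\<bar>E $ i $ j\<bar> \<le> 1" for i j unfolding E_def round_matrix_def by simp linarith
    then have "l1_norm (E $ i) \<le> real CARD('n)" for i
      unfolding l1_norm_def using sum_bounded_above[of UNIV "\<lambda>j. \<bar>E $ i $ j\<bar>" 1] by simp
    then have EN: "(\<Sum>i\<in>UNIV. l1_norm (E $ i)) \<le> N"
      using sum_bounded_above[of UNIV "\<lambda>i. l1_norm (E $ i)" "real CARD('n)"] by (simp add: N_def)
    have "l1_norm c = l1_norm ((c v* v) v* u)" by (simp add: vector_matrix_mul_assoc u)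
    also have "\<dots> \<le> M * l1_norm (c v* v)" unfolding M_def by (rule l1_norm_vector_matrix_mult)
    also have "\<dots> \<le> M * (2 * diff_norm (c v* v))" by (intro mult_left_mono l1_norm_le_diff_norm M)
    finally have c: "l1_norm c \<le> M * (2 * diff_norm (c v* v))" .
    have "diff_norm (c v* E) \<le> (\<Sum>i\<in>UNIV. l1_norm (E $ i)) * l1_norm c"
      by (rule order_trans[OF diff_norm_le_l1_norm l1_norm_vector_matrix_mult])
    also have "\<dots> \<le> N * l1_norm c" by (intro mult_right_mono EN l1_norm_nonneg)
    also have "\<dots> \<le> N * (M * (2 * diff_norm (c v* v)))" by (intro mult_left_mono c N)
    finally have E: "diff_norm (c v* E) \<le> N * M * 2 * diff_norm (c v* v)" by (simp add: mult.assoc)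
    have "c v* (t *\<^sub>R v) = c v* round_matrix t v + c v* E"
      by (simp add: E_def vector_matrix_mult_diff_rdistrib)
    then have "t *\<^sub>R (c v* v) = c v* round_matrix t v + c v* E"
      by (simp add: vector_scaleR_matrix_ac)
    then have "diff_norm (t *\<^sub>R (c v* v)) \<le> diff_norm (c v* round_matrix t v) + diff_norm (c v* E)"
      using diff_norm_triangle by metis
    then show ?thesis using E that by (simp add: diff_norm_scaleR algebra_simps)
  qed
  then show ?thesis using M N by (intro exI[of _ "N * M * 2"]) auto
qed

lemma det_scaleR: "det (a *\<^sub>R A) = a ^ CARD('n) * det A" for A :: "real^'n^'n"
proof -
  have "a *\<^sub>R A = (\<chi> i. a *s (A $ i))" by (simp add: vec_eq_iff)
  then show ?thesis using det_rows_mul[of "\<lambda>_. a" "\<lambda>i. A $ i"] by simp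
qed

lemma det_round_matrix_asymptotics:
  fixes v :: "real^'n^'n"
  shows "(\<lambda>h. \<bar>det (round_matrix (real h + a) v)\<bar> / real h ^ CARD('n)) \<longlonglongrightarrow> \<bar>det v\<bar>"
proof -
  have lim: "(\<lambda>h. real_of_int \<lfloor>(real h + a) * x\<rfloor> / real h) \<longlonglongrightarrow> x" for x
  proof (rule Lim_transform2[OF _ Lim_null_comparison])
    show "(\<lambda>h. x + (a * x) / real h) \<longlonglongrightarrow> x"
      using tendsto_add[OF tendsto_const[of x] tendsto_mult[OF tendsto_const[of "a * x"] lim_1_over_n]] by simp
    show "(\<lambda>h. 1 / real h) \<longlonglongrightarrow> 0" by (rule lim_1_over_n)
    show "\<forall>\<^sub>F h in sequentially. norm (x + (a * x) / real h - real_of_int \<lfloor>(real h + a) * x\<rfloor> / real h) \<le> 1 / real h"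
      using eventually_gt_at_top[of 0]
    proof eventually_elim
      case (elim h)
      have "x + (a * x) / real h - real_of_int \<lfloor>(real h + a) * x\<rfloor> / real h
          = ((real h + a) * x - real_of_int \<lfloor>(real h + a) * x\<rfloor>) / real h"
        using elim by (simp add: field_simps)
      moreover have "\<bar>(real h + a) * x - real_of_int \<lfloor>(real h + a) * x\<rfloor>\<bar> \<le> 1" by linarith
      ultimately show ?case using elim by (simp add: divide_right_mono)
    qed
  qed
  have entry: "(\<lambda>h. ((1 / real h) *\<^sub>R round_matrix (real h + a) v) $ i $ j) \<longlonglongrightarrow> v $ i $ j" for i j
    by (simp add: round_matrix_def lim)
  have "(\<lambda>h. det ((1 / real h) *\<^sub>R round_matrix (real h + a) v)) \<longlonglongrightarrow> det v"
    unfolding det_def by (intro tendsto_sum tendsto_mult tendsto_const tendsto_prod entry)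
  then have "(\<lambda>h. \<bar>det ((1 / real h) *\<^sub>R round_matrix (real h + a) v)\<bar>) \<longlonglongrightarrow> \<bar>det v\<bar>"
    by (rule tendsto_rabs)
  then show ?thesis by (simp add: det_scaleR abs_mult power_divide)
qed

text \<open>The scale is \<open>h + a\<close> with \<open>a = C + 1\<close>: the constant \<open>C\<close> absorbs the rounding error and the
  additional \<open>1\<close> turns \<open>diff_norm \<ge> h\<close> into the strict inequality that the \<open>B\<^sub>h\<close> property requires.\<close>

lemma Bh_order_le_det_round_matrix:
  fixes v :: "real^'n^'n"
  assumes "det v \<noteq> 0" "lattice_packing \<triangle> (int_span v)"
  shows "\<exists>a. \<forall>h\<ge>1. is_Bh_order h CARD('n) (\<phi> h CARD('n)) \<and>
           real (\<phi> h CARD('n)) \<le> \<bar>det (round_matrix (real h + a) v)\<bar>"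
proof -
  obtain C where "C \<ge> 0"
    and C: "\<And>t c. t \<ge> 0 \<Longrightarrow> (t - C) * diff_norm (c v* v) \<le> diff_norm (c v* round_matrix t v)"
    using diff_norm_round_matrix[OF assms(1)] by blast
  have "is_Bh_order h CARD('n) (\<phi> h CARD('n)) \<and> real (\<phi> h CARD('n)) \<le> \<bar>det (round_matrix (real h + (C + 1)) v)\<bar>"
    if "h \<ge> 1" for h
  proof -
    let ?w = "round_matrix (real h + (C + 1)) v"
    have le: "(real h + 1) * diff_norm (c v* v) \<le> diff_norm (c v* ?w)" for c
      using C[of "real h + (C + 1)" c] \<open>C \<ge> 0\<close> by simp
    have far: "real h < diff_norm (c v* ?w)" if "c \<in> int_vecs" "c \<noteq> 0" for c
    proof -
      have "1 \<le> diff_norm (c v* v)" using assms that lattice_packing_simplex_iff by blast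
      then have "(real h + 1) * 1 \<le> (real h + 1) * diff_norm (c v* v)" by (intro mult_left_mono) auto
      also note le[of c]
      finally show ?thesis by simp
    qed
    have "det ?w \<noteq> 0"
    proof
      assume "det ?w = 0"
      then have "det (transpose ?w) = 0" by simp
      then obtain c where "c \<noteq> 0" "c v* ?w = 0"
        using invertible_det_nz[of "transpose ?w"] invertible_left_inverse[of "transpose ?w"]
          matrix_left_invertible_ker[of "transpose ?w"] by auto
      then have "(real h + 1) * diff_norm (c v* v) \<le> 0" using le[of c] by simp
      moreover have "0 < diff_norm (c v* v)"
        using diff_norm_pos vector_matrix_mult_eq_0[OF assms(1)] \<open>c \<noteq> 0\<close> by blast
      ultimately show False by (simp add: mult_le_0_iff)
    qed
    from Bh_order_le_det[OF that this round_matrix_int_vecs far] show ?thesis by simp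
  qed
  then show ?thesis by blast
qed

section \<open>The packing density of the simplex\<close>

text \<open>The translates of the interior are disjoint, so its volume is at most the determinant, and the
  frontier of a convex set is negligible. The bound gives the supremum that defines
  \<open>lattice_packing_density\<close> its meaning.\<close>

lemma packing_density_le_1:
  fixes K :: "(real^'n) set"
  assumes "convex K" "bounded K" "lattice_packing K L"
  shows "packing_density K L \<le> 1"
proof -
  obtain v where v: "lattice_basis v L" using assms(3) by (auto simp: lattice_packing_def is_lattice_def)
  then have L: "L = int_span v" and det: "det v \<noteq> 0"
    by (auto simp: lattice_basis_def lin_indep_rows_iff_det)
  have "measure lebesgue (interior K) \<le> \<bar>det v\<bar>"
  proof (rule measure_le_det_of_disjoint_translates[OF det lmeasurable_interior[OF assms(2)]])
    fix x y assume "x \<in> int_span v" "y \<in> int_span v" "x \<noteq> y"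
    then show "(+) x ` interior K \<inter> (+) y ` interior K = {}"
      using assms(3) by (simp add: lattice_packing_def L interior_translation)
  qed
  moreover have "measure lebesgue (interior K) = measure lebesgue K"
    by (rule measure_interior[OF assms(2) negligible_convex_frontier[OF assms(1)]])
  ultimately show ?thesis
    using det by (simp add: packing_density_def lattice_det_eq[OF v])
qed

lemma convex_simplex_body: "convex (\<triangle> :: (real^'n) set)"
proof -
  have "x $ i * u + y $ i * w \<ge> 0" if "0 \<le> x $ i" "0 \<le> y $ i" "0 \<le> u" "0 \<le> w" for x y :: "real^'n" and u w i
    using that by simp
  then show ?thesis
    unfolding convex_def simplex_body_def
    by (auto simp: sum.distrib simp flip: sum_distrib_left intro: convex_bound_le)
qed

lemma bounded_simplex_body: "bounded (\<triangle> :: (real^'n) set)"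
proof (rule bounded_subset[OF bounded_cbox[of 0 1]])
  show "\<triangle> \<subseteq> cbox 0 (1 :: real^'n)"
  proof
    fix x :: "real^'n" assume x: "x \<in> \<triangle>"
    then have "x $ i \<le> (\<Sum>i\<in>UNIV. x $ i)" for i by (intro member_le_sum) (auto simp: simplex_body_def)
    then have "x $ i \<le> 1" for i using x by (auto simp: simplex_body_def intro: order_trans)
    then show "x \<in> cbox 0 1" using x by (simp add: simplex_body_def mem_box_cart)
  qed
qed

lemma bdd_above_packing_density_simplex:
  "bdd_above (packing_density (\<triangle> :: (real^'n) set) ` {L. lattice_packing \<triangle> L})"
  using packing_density_le_1[OF convex_simplex_body bounded_simplex_body] by (intro bdd_aboveI2[of _ _ 1]) auto

lemma packing_density_simplex_int_span:
  fixes v :: "real^'n^'n"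
  assumes "det v \<noteq> 0"
  shows "packing_density \<triangle> (int_span v) = 1 / (fact CARD('n) * \<bar>det v\<bar>)"
  using lattice_det_eq[OF lattice_basis_int_span[OF assms]] by (simp add: packing_density_def measure_simplex)

text \<open>One explicit packing shows that the packing density is positive and, through rounding, that for
  each \<open>h \<ge> 1\<close> some group contains a \<open>B\<^sub>h\<close> set.\<close>

lemma lattice_packing_simplex_mat_1: "lattice_packing \<triangle> (int_span (mat 1 :: real^'n^'n))"
proof -
  have "1 \<le> diff_norm c" if "c \<in> int_vecs" "c \<noteq> 0" for c :: "real^'n"
  proof (rule ccontr)
    assume "\<not> 1 \<le> diff_norm c"
    then have lt: "(\<Sum>i\<in>UNIV. max (c $ i) 0) < 1" "(\<Sum>i\<in>UNIV. max (- c $ i) 0) < 1"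
      by (auto simp: diff_norm_eq_max)
    have "max (c $ i) 0 < 1" "max (- c $ i) 0 < 1" for i
      using lt member_le_sum[of i UNIV "\<lambda>i. max (c $ i) 0"] member_le_sum[of i UNIV "\<lambda>i. max (- c $ i) 0"]
      by auto
    then have "c $ i = 0" for i
      using that(1) Ints_nonzero_abs_ge1[of "c $ i"] \<open>\<And>i. max (c $ i) 0 < 1\<close>[of i] \<open>\<And>i. max (- c $ i) 0 < 1\<close>[of i]
      by (cases "c $ i = 0") (auto simp: int_vecs_def abs_less_iff simp flip: not_less)
    then show False using that(2) by (simp add: vec_eq_iff)
  qed
  then show ?thesis by (subst lattice_packing_simplex_iff) auto
qed

lemma le_lattice_packing_density_simplex:
  fixes v :: "real^'n^'n"
  assumes "det v \<noteq> 0" "lattice_packing \<triangle> (int_span v)"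
  shows "1 / (fact CARD('n) * \<bar>det v\<bar>) \<le> \<delta>\<^sub>L (\<triangle> :: (real^'n) set)"
  unfolding lattice_packing_density_def packing_density_simplex_int_span[OF assms(1), symmetric]
  using assms(2) by (intro cSUP_upper bdd_above_packing_density_simplex) simp

lemma lattice_packing_density_simplex_pos: "0 < \<delta>\<^sub>L (\<triangle> :: (real^'n) set)"
  using le_lattice_packing_density_simplex[OF _ lattice_packing_simplex_mat_1[where 'n = 'n]]
  by (simp add: order.strict_trans2[rotated])

section \<open>The two bounds\<close>

lemma Bh_order_lower_bound:
  assumes "h \<ge> 1"
  shows "real h ^ CARD('n) \<le> fact CARD('n) * \<delta>\<^sub>L (\<triangle> :: (real^'n::finite) set) * real (\<phi> h CARD('n))"
proof -
  have "is_Bh_order h CARD('n) (\<phi> h CARD('n))"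
    using Bh_order_le_det_round_matrix[OF _ lattice_packing_simplex_mat_1[where 'n = 'n]] assms by auto
  then obtain G :: "nat monoid" and B where G: "comm_group G" "finite (carrier G)"
    "order G = \<phi> h CARD('n)" "Bh_set G h CARD('n) B"
    by (auto simp: is_Bh_order_def)
  obtain e :: "nat \<Rightarrow> 'n" where e: "bij_betw e {1..CARD('n)} UNIV"
    using ex_bij_betw_nat_finite_1[of "UNIV :: 'n set"] by auto
  obtain \<psi> where \<psi>: "\<psi> \<in> hom int_vec_group G"
    and far: "\<And>x :: real^'n. \<lbrakk>x \<in> int_vecs; \<psi> x = \<one>\<^bsub>G\<^esub>; x \<noteq> 0\<rbrakk> \<Longrightarrow> real h < diff_norm x"
    using Bh_set_imp_hom[OF G(1,4) e] by blast
  obtain w :: "real^'n^'n" where w: "det w \<noteq> 0" "int_span w = {x \<in> int_vecs. \<psi> x = \<one>\<^bsub>G\<^esub>}"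
    "\<bar>det w\<bar> \<le> real (order G)"
    using hom_kernel_lattice[OF G(1,2) \<psi>] by blast
  define v where "v = (1 / real h) *\<^sub>R w"
  have det: "det v = det w / real h ^ CARD('n)" by (simp add: v_def det_scaleR power_divide)
  then have det0: "det v \<noteq> 0" using w(1) assms by simp
  have "1 \<le> diff_norm (c v* v)" if "c \<in> int_vecs" "c \<noteq> 0" for c
  proof -
    have "c v* w \<in> int_span w" using that(1) by (auto simp: int_span_eq_image)
    moreover have "c v* w \<noteq> 0" using vector_matrix_mult_eq_0[OF w(1)] that(2) by blast
    ultimately have "real h < diff_norm (c v* w)" using far w(2) by auto
    then show ?thesis using assms
      by (simp add: v_def vector_scaleR_matrix_ac diff_norm_scaleR field_simps)
  qed
  then have "lattice_packing \<triangle> (int_span v)" using lattice_packing_simplex_iff[OF det0] by blast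
  then have "1 / (fact CARD('n) * \<bar>det v\<bar>) \<le> \<delta>\<^sub>L (\<triangle> :: (real^'n) set)"
    by (rule le_lattice_packing_density_simplex[OF det0])
  then have "real h ^ CARD('n) \<le> fact CARD('n) * \<delta>\<^sub>L (\<triangle> :: (real^'n) set) * \<bar>det w\<bar>"
    using w(1) assms by (simp add: det abs_divide field_simps)
  also have "\<dots> \<le> fact CARD('n) * \<delta>\<^sub>L (\<triangle> :: (real^'n) set) * real (\<phi> h CARD('n))"
  proof (rule mult_left_mono)
    show "\<bar>det w\<bar> \<le> real (\<phi> h CARD('n))" using w(3) G(3) by simp
    show "0 \<le> fact CARD('n) * \<delta>\<^sub>L (\<triangle> :: (real^'n) set)"
      using lattice_packing_density_simplex_pos[where 'n = 'n] by simp
  qed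
  finally show ?thesis .
qed

lemma Bh_order_upper_bound:
  assumes "x > 1 / (fact CARD('n) * \<delta>\<^sub>L (\<triangle> :: (real^'n::finite) set))"
  shows "\<forall>\<^sub>F h in sequentially. real (\<phi> h CARD('n)) < x * real h ^ CARD('n)"
proof -
  let ?\<delta> = "\<delta>\<^sub>L (\<triangle> :: (real^'n) set)"
  have pos: "0 < ?\<delta>" by (rule lattice_packing_density_simplex_pos)
  have "x > 0" using assms pos by (smt (verit) divide_nonneg_nonneg fact_ge_zero mult_nonneg_nonneg)
  then have "1 / (fact CARD('n) * x) < ?\<delta>" using assms pos by (simp add: field_simps)
  then obtain L :: "(real^'n) set" where L: "lattice_packing \<triangle> L" "1 / (fact CARD('n) * x) < packing_density \<triangle> L"
    unfolding lattice_packing_density_def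
    using less_cSUP_iff[OF _ bdd_above_packing_density_simplex] lattice_packing_simplex_mat_1[where 'n = 'n] by auto
  obtain v where "lattice_basis v L" using L(1) by (auto simp: lattice_packing_def is_lattice_def)
  then have v: "L = int_span v" "det v \<noteq> 0" by (auto simp: lattice_basis_def lin_indep_rows_iff_det)
  have "\<bar>det v\<bar> < x"
    using L(2) \<open>x > 0\<close> v(2) unfolding v(1) packing_density_simplex_int_span[OF v(2)] by (simp add: field_simps)
  obtain a where a: "\<And>h. h \<ge> 1 \<Longrightarrow> real (\<phi> h CARD('n)) \<le> \<bar>det (round_matrix (real h + a) v)\<bar>"
    using Bh_order_le_det_round_matrix[OF v(2)] L(1) v(1) by blast
  have "\<forall>\<^sub>F h in sequentially. \<bar>det (round_matrix (real h + a) v)\<bar> / real h ^ CARD('n) < x"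
    by (rule order_tendstoD(2)[OF det_round_matrix_asymptotics \<open>\<bar>det v\<bar> < x\<close>])
  then show ?thesis
    using eventually_ge_at_top[of 1]
  proof eventually_elim
    case (elim h)
    then have "\<bar>det (round_matrix (real h + a) v)\<bar> < x * real h ^ CARD('n)" by (simp add: field_simps)
    then show ?case using a[OF elim(2)] by linarith
  qed
qed

theorem theorem2p1:
  fixes n :: nat
  assumes "n = CARD('n::finite)"
  shows "(\<forall>\<epsilon>::real. \<epsilon> > 0 \<longrightarrow>
            (\<exists>h\<^sub>0::nat.
               (\<forall>h::nat. h \<ge> 1 \<longrightarrow>
                  1 / (fact n * \<delta>\<^sub>L (\<triangle> :: (real^'n) set)) * real h ^ n \<le> real (\<phi> h n)) \<and>
               (\<forall>h::nat. h \<ge> 1 \<and> h \<ge> h\<^sub>0 \<longrightarrow>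
                  real (\<phi> h n) < (1 + \<epsilon>) / (fact n * \<delta>\<^sub>L (\<triangle> :: (real^'n) set)) * real h ^ n))) \<and>
         (\<lambda>h. real (\<phi> h n) / real h ^ n)
            \<longlonglongrightarrow> 1 / (fact n * \<delta>\<^sub>L (\<triangle> :: (real^'n) set))"
proof -
  define c where "c = 1 / (fact n * \<delta>\<^sub>L (\<triangle> :: (real^'n) set))"
  have pos: "0 < \<delta>\<^sub>L (\<triangle> :: (real^'n) set)" by (rule lattice_packing_density_simplex_pos)
  then have "c > 0" by (simp add: c_def)
  have lower: "c * real h ^ n \<le> real (\<phi> h n)" if "h \<ge> 1" for h
    using Bh_order_lower_bound[OF that, where 'n = 'n] pos by (simp add: c_def assms field_simps)
  have upper: "\<forall>\<^sub>F h in sequentially. real (\<phi> h n) < x * real h ^ n" if "c < x" for x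
    using Bh_order_upper_bound[where 'n = 'n] that unfolding c_def assms by blast
  have "\<exists>h\<^sub>0. \<forall>h\<ge>h\<^sub>0. real (\<phi> h n) < (1 + \<epsilon>) * c * real h ^ n" if "\<epsilon> > 0" for \<epsilon> :: real
    using upper[of "(1 + \<epsilon>) * c"] that \<open>c > 0\<close> by (simp add: eventually_sequentially)
  moreover have "(1 + \<epsilon>) / (fact n * \<delta>\<^sub>L (\<triangle> :: (real^'n) set)) = (1 + \<epsilon>) * c" for \<epsilon> :: real
    by (simp add: c_def)
  moreover have "(\<lambda>h. real (\<phi> h n) / real h ^ n) \<longlonglongrightarrow> c"
  proof (rule order_tendstoI)
    fix x assume "x < c"
    show "\<forall>\<^sub>F h in sequentially. x < real (\<phi> h n) / real h ^ n"
      using eventually_ge_at_top[of 1]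
    proof eventually_elim
      case (elim h)
      then have "c \<le> real (\<phi> h n) / real h ^ n" using lower by (simp add: pos_le_divide_eq)
      then show ?case using \<open>x < c\<close> by linarith
    qed
  next
    fix x assume "c < x"
    from upper[OF this] eventually_ge_at_top[of 1]
    show "\<forall>\<^sub>F h in sequentially. real (\<phi> h n) / real h ^ n < x"
      by eventually_elim (simp add: pos_divide_less_eq)
  qed
  ultimately show ?thesis using lower unfolding c_def[symmetric] by metis
qed

end
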